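(* Let $\mu$ be a non-zero (positive Borel) measure on $\mathbb{R}$ with support contained in a compact interval $[a,b]$, such that $\mu$ has a density $\rho$ (with $\rho\ge 0$ and $\rho=0$ outside $[a,b]$) whose restriction to $(a,b)$ lies in $W^{1,p}(a,b)$ for some $1<p<\infty$ (the absolutely continuous representative being taken on $(a,b)$; jump discontinuities of $\rho$ at the endpoints $a$ and $b$ are allowed). Let $S\subset\mathbb{R}$ be an arbitrary nowhere dense set. Then for every $\zeta\in\mathbb{C}$ the number of solutions $z\in\mathbb{C}\setminus\operatorname{supp}(\mu)$, counted with multiplicity, of $G_\mu(z)=\zeta$ is bounded above by $$N=\frac12\,\sup_{y>0,\;y\notin S} C\bigl(\{x\in\mathbb{R}:(x,y)\in\mathcal{G}(\rho)\}\bigr),$$ where $\mathcal{G}(\rho)$ is the modified graph of $\rho:\mathbb{R}\to\mathbb{R}$.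
   Context: The Stieltjes transform of $\mu$ is $G_\mu(z)=\int \frac{1}{z-x}\,\mathrm{d}\mu(x)$ for $z\in\mathbb{C}\setminus\operatorname{supp}(\mu)$. For $A\subset\mathbb{R}$, $C(A)\in\mathbb{N}\cup\{\infty\}$ denotes the number of connected components of $A$, i.e. the number of equivalence classes of the relation on $A$ where $s\sim t$ iff the closed interval between $s$ and $t$ is contained in $A$ ($C(A)=\infty$ if there are infinitely many; $C(\emptyset)=0$). For $U\subset\mathbb{R}$ and a function $f:U\to\mathbb{R}$ with finitely many points of discontinuity whose left and right limits exist (possibly infinite) at every point of $U$, the modified graph of $f$ is $$\mathcal{G}(f)=\Bigl\{(x,y)\in U\times\mathbb{R}: y\text{ lies (inclusively) between }\lim_{z\uparrow x}f(z)\text{ and }\lim_{z\downarrow x}f(z)\Bigr\}.$$ If $N=\infty$ the bound is vacuous. *)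

theory Defs
  imports "HOL-Complex_Analysis.Complex_Analysis"
begin

definition measure_support :: "real measure \<Rightarrow> real set" where
  "measure_support \<mu> = {x. \<forall>U. open U \<and> x \<in> U \<longrightarrow> emeasure \<mu> U > 0}"

text \<open>For \<open>z\<close> in \<open>complex_of_real ` measure_support \<mu>\<close> the value is
  meaningless; only points outside the support are ever considered.\<close>

definition stieltjes_transform :: "real measure \<Rightarrow> complex \<Rightarrow> complex" where
  "stieltjes_transform \<mu> z = (\<integral>x. 1 / (z - complex_of_real x) \<partial>\<mu>)"

text \<open>The sum is a supremum of finite partial sums, so it is infinite when there are
  infinitely many solutions. For \<open>f\<close> holomorphic at a solution \<open>z\<close> and not locally constant
  there, \<open>zorder (\<lambda>w. f w - \<zeta>) z\<close> is the usual multiplicity, and it is at least 1.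
  It carries no meaning where \<open>f\<close> is locally constant. The Stieltjes transform of a non-zero
  measure with compact support in the real line is nowhere locally constant off the support,
  by connectedness of the complement and its behaviour \<open>\<mu>(\<real>) / z\<close> at infinity.\<close>

definition num_solutions :: "(complex \<Rightarrow> complex) \<Rightarrow> complex set \<Rightarrow> complex \<Rightarrow> ennreal" where
  "num_solutions f D \<zeta> =
     (\<Sum>\<^sub>\<infinity> z\<in>{z\<in>D. f z = \<zeta>}. of_nat (nat (zorder (\<lambda>w. f w - \<zeta>) z)))"

definition segment_rel :: "real set \<Rightarrow> (real \<times> real) set" where
  "segment_rel A = {(s, t). s \<in> A \<and> t \<in> A \<and> closed_segment s t \<subseteq> A}"

definition num_components :: "real set \<Rightarrow> enat" where
  "num_components A =
     (if finite (A // segment_rel A) then enat (card (A // segment_rel A)) else \<infinity>)"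

text \<open>One-sided limits are taken in the extended reals. A point \<open>x\<close> at which one of
  them fails to exist contributes nothing to the graph.\<close>

definition modified_graph :: "(real \<Rightarrow> real) \<Rightarrow> (real \<times> real) set" where
  "modified_graph f = {(x, y). \<exists>l r :: ereal.
     ((\<lambda>z. ereal (f z)) \<longlongrightarrow> l) (at_left x) \<and>
     ((\<lambda>z. ereal (f z)) \<longlongrightarrow> r) (at_right x) \<and>
     min l r \<le> ereal y \<and> ereal y \<le> max l r}"

definition memLp :: "(real \<Rightarrow> real) \<Rightarrow> real \<Rightarrow> real set \<Rightarrow> bool" where
  "memLp f p A \<longleftrightarrow> set_borel_measurable lborel A f \<and>
     set_integrable lborel A (\<lambda>x. \<bar>f x\<bar> powr p)"

definition test_function :: "(real \<Rightarrow> real) \<Rightarrow> real set \<Rightarrow> bool" where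
  "test_function \<phi> A \<longleftrightarrow> (\<forall>k. (deriv ^^ k) \<phi> differentiable_on UNIV) \<and>
     (\<exists>K. compact K \<and> K \<subseteq> A \<and> (\<forall>x. x \<notin> K \<longrightarrow> \<phi> x = 0))"

definition weak_derivative :: "(real \<Rightarrow> real) \<Rightarrow> (real \<Rightarrow> real) \<Rightarrow> real set \<Rightarrow> bool" where
  "weak_derivative f g A \<longleftrightarrow> (\<forall>\<phi>. test_function \<phi> A \<longrightarrow>
     (LINT x:A|lborel. f x * deriv \<phi> x) = - (LINT x:A|lborel. g x * \<phi> x))"

text \<open>\<open>W\<^sup>1\<^sup>,\<^sup>p(A)\<close> for an open set \<open>A\<close> of reals, stated for functions rather than classes
  modulo null sets; only the values on \<open>A\<close> matter.\<close>

definition sobolev_W1 :: "real \<Rightarrow> real set \<Rightarrow> (real \<Rightarrow> real) set" where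
  "sobolev_W1 p A = {f. memLp f p A \<and> (\<exists>g. memLp g p A \<and> weak_derivative f g A)}"

text \<open>The usual \<open>\<epsilon>\<close>-\<open>\<delta>\<close> definition: \<open>d division_of \<Union>d\<close> says that \<open>d\<close> is a finite set of
  non-empty compact intervals with pairwise disjoint interiors.\<close>

definition abs_continuous_on :: "real set \<Rightarrow> (real \<Rightarrow> real) \<Rightarrow> bool" where
  "abs_continuous_on A f \<longleftrightarrow> (\<forall>\<epsilon>>0. \<exists>\<delta>>0. \<forall>d.
     d division_of \<Union>d \<and> \<Union>d \<subseteq> A \<and> (\<Sum>k\<in>d. Sup k - Inf k) < \<delta> \<longrightarrow>
     (\<Sum>k\<in>d. \<bar>f (Sup k) - f (Inf k)\<bar>) < \<epsilon>)"

end

theory Submission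
  imports Defs
begin

text \<open>Let \<open>G\<close> be the Stieltjes transform. On the upper half plane \<open>Im G <
  0\<close>, and its boundary values have imaginary part \<open>- \<pi> \<rho>\<close>. So for \<open>Im
  \<zeta> = - \<pi> y\<close> with \<open>y > 0\<close> all solutions of \<open>G z = \<zeta>\<close> lie
  in the upper half plane and the imaginary part of \<open>G - \<zeta>\<close> on the real line is
  \<open>- \<pi> (\<rho> - y)\<close>. If \<open>\<rho> - y\<close> changes sign at the \<open>n\<close>
  points of \<open>Y\<close>, then \<open>q = (\<Prod>t\<in>Y. x - t)\<close> makes \<open>(\<rho> - y)
  q\<close> of constant sign. Given solutions \<open>z\<^sub>1, \<dots>, z\<^sub>m\<close> with \<open>2
  m > n\<close>, the function \<open>h = (G - \<zeta>) q / (\<Prod>j. (z - z\<^sub>j) (z - cnj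
  z\<^sub>j))\<close> is holomorphic in the upper half plane and, since \<open>n\<close> is even
  (\<open>\<rho> - y\<close> is negative at both ends of the line), decays like \<open>1 /
  z\<^sup>2\<close>. Its integral over the real line is therefore \<open>0\<close>, although its
  imaginary part there has constant sign and is not zero: a contradiction, so \<open>2 m \<le> n\<close>.

  Expanding the rational factor of \<open>h\<close> into partial fractions turns the claim
  \<open>\<integral> Im h = 0\<close> into an identity between the values of \<open>G\<close> at the
  solutions and elementary principal values, without a passage to the boundary; this is
  \<open>level_crossings_bound_zeros\<close>.

  What remains is a reduction to this estimate. Displacing \<open>\<zeta>\<close> slightly replaces every
  multiple solution by as many distinct ones, also when the solution is real and \<open>\<zeta>\<close>
  is real (\<open>solutions_stable\<close>). The displacement can be chosen such that \<open>Im \<zeta> =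
  \<plusminus> \<pi> y\<close> with \<open>y > 0\<close> outside the nowhere dense set \<open>S\<close>,
  and complex conjugation reduces to \<open>Im \<zeta> < 0\<close>. Finally, \<open>\<rho>\<close> is
  uniformly continuous on \<open>(a, b)\<close> by absolute continuity, so that the sign of \<open>\<rho>
  - y\<close> can only change across a component of the level set of the modified graph
  (\<open>two_card_solutions_le_components\<close>).\<close>

section \<open>Multiplicities and nearby values\<close>

text \<open>Near a zero of order \<open>n\<close> the function \<open>f - f z\<close> is the \<open>n\<close>-th power of a holomorphic
  \<open>\<phi>\<close> with a simple zero at \<open>z\<close>. The image of \<open>\<phi>\<close> is open, so it contains all \<open>n\<close> distinct
  \<open>n\<close>-th roots of every sufficiently small non-zero number, and each of these roots is attained
  at a point of its own.\<close>
lemma zorder_many_preimages: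
  fixes f :: "complex \<Rightarrow> complex"
  assumes holf: "f holomorphic_on ball z r" and r: "0 < r"
    and nonconst: "\<not> f constant_on ball z r"
  obtains \<delta> where "0 < \<delta>"
    "\<And>\<zeta>. 0 < dist \<zeta> (f z) \<Longrightarrow> dist \<zeta> (f z) < \<delta> \<Longrightarrow>
      \<exists>W \<subseteq> ball z r. finite W \<and> card W = nat (zorder (\<lambda>w. f w - f z) z) \<and> (\<forall>w\<in>W. f w = \<zeta>)"
proof -
  define n where "n = nat (zorder (\<lambda>w. f w - f z) z)"
  define g where "g = zor_poly (\<lambda>w. f w - f z) z"
  have "\<exists>w\<in>ball z r. f w - f z \<noteq> 0"
    using nonconst unfolding constant_on_def by auto
  moreover have "(\<lambda>w. f w - f z) holomorphic_on ball z r"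
    by (intro holomorphic_intros holf)
  ultimately have zo: "zorder (\<lambda>w. f w - f z) z > 0" and
    "\<exists>s. s > 0 \<and> cball z s \<subseteq> ball z r \<and> g holomorphic_on cball z s \<and>
      (\<forall>w\<in>cball z s. f w - f z = g w * (w - z) ^ n \<and> g w \<noteq> 0)"
    using zorder_exist_zero[of "\<lambda>w. f w - f z" "ball z r" z] r
    unfolding n_def g_def by auto
  then obtain s where s: "0 < s" "cball z s \<subseteq> ball z r" "g holomorphic_on cball z s"
    "\<And>w. w \<in> cball z s \<Longrightarrow> f w - f z = g w * (w - z) ^ n" "\<And>w. w \<in> cball z s \<Longrightarrow> g w \<noteq> 0"
    by blast
  have n: "n > 0" using zo by (simp add: n_def)
  have "g holomorphic_on ball z s"
    using s(3) by (rule holomorphic_on_subset) auto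
  then obtain h where h: "h holomorphic_on ball z s" "\<And>w. w \<in> ball z s \<Longrightarrow> g w = exp (h w)"
    using contractible_imp_holomorphic_log[of g "ball z s"] s(5)
    by (metis convex_ball convex_imp_contractible ball_subset_cball subsetD)
  \<comment> \<open>An \<open>n\<close>-th root of \<open>f - f z\<close> near \<open>z\<close>, with a simple zero at \<open>z\<close>.\<close>
  define \<phi> where "\<phi> w = (w - z) * exp (h w / of_nat n)" for w
  have hol\<phi>: "\<phi> holomorphic_on ball z s"
    unfolding \<phi>_def using n by (intro holomorphic_intros h(1)) auto
  have \<phi>_pow: "f w - f z = \<phi> w ^ n" if "w \<in> ball z s" for w
    using s(4)[of w] h(2)[OF that] n that
    by (simp add: \<phi>_def power_mult_distrib flip: exp_of_nat_mult)
  have \<phi>z: "\<phi> z = 0" by (simp add: \<phi>_def)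
  have "\<not> \<phi> constant_on ball z s"
  proof
    assume "\<phi> constant_on ball z s"
    then obtain c where c: "\<And>w. w \<in> ball z s \<Longrightarrow> \<phi> w = c" unfolding constant_on_def by blast
    have zs: "z + of_real (s/2) \<in> ball z s" "z \<in> ball z s"
      using s(1) by (auto simp: dist_norm)
    have "\<phi> (z + of_real (s/2)) = 0" using c[OF zs(1)] c[OF zs(2)] \<phi>z by simp
    then show False using s(1) by (simp add: \<phi>_def)
  qed
  then have "open (\<phi> ` ball z s)"
    using open_mapping_thm[OF hol\<phi> open_ball connected_ball open_ball subset_refl] by simp
  moreover have "0 \<in> \<phi> ` ball z s"
    using \<phi>z s(1) by (metis centre_in_ball imageI)
  ultimately obtain e where e: "0 < e" "ball 0 e \<subseteq> \<phi> ` ball z s"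
    by (meson open_contains_ball)
  show thesis
  proof
    show "0 < e ^ n" using e by simp
  next
    fix \<zeta> assume \<zeta>: "0 < dist \<zeta> (f z)" "dist \<zeta> (f z) < e ^ n"
    define R where "R = {u. u ^ n = \<zeta> - f z}"
    have cR: "card R = n" unfolding R_def using \<zeta>(1) n by (intro card_nth_roots) auto
    then have fR: "finite R" using n by (metis card.infinite less_irrefl)
    have "R \<subseteq> \<phi> ` ball z s"
    proof
      fix u assume "u \<in> R"
      then have "norm u ^ n < e ^ n" using \<zeta>(2) by (simp add: R_def dist_norm flip: norm_power)
      then have "u \<in> ball 0 e" using e(1) by (auto simp: power_less_imp_less_base)
      then show "u \<in> \<phi> ` ball z s" using e(2) by blast
    qed
    then obtain W where W: "W \<subseteq> ball z s" "inj_on \<phi> W" "R = \<phi> ` W"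
      by (meson subset_image_inj)
    show "\<exists>W \<subseteq> ball z r. finite W \<and> card W = nat (zorder (\<lambda>w. f w - f z) z) \<and> (\<forall>w\<in>W. f w = \<zeta>)"
    proof (intro exI[of _ W] conjI ballI)
      show "W \<subseteq> ball z r" using W(1) s(2) ball_subset_cball by blast
      show "finite W" using W fR by (metis finite_imageD)
      show "card W = nat (zorder (\<lambda>w. f w - f z) z)"
        using W cR by (simp add: card_image n_def)
      show "f w = \<zeta>" if "w \<in> W" for w
      proof -
        have "\<phi> w ^ n = \<zeta> - f z" using W(3) that unfolding R_def by blast
        then show ?thesis using \<phi>_pow[of w] that W(1) by auto
      qed
    qed
  qed
qed

text \<open>A small displacement of the value turns a solution of multiplicity \<open>n\<close> into at least \<open>n\<close>
  distinct solutions. Multiplicities thereby disappear from the problem: it is enough to bound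
  numbers of distinct solutions, and the displaced value can be chosen freely in a punctured disc.\<close>
lemma solutions_stable:
  fixes f :: "complex \<Rightarrow> complex"
  assumes "open D" and holf: "f holomorphic_on D"
    and nonconst: "\<And>z r. 0 < r \<Longrightarrow> ball z r \<subseteq> D \<Longrightarrow> \<not> f constant_on ball z r"
    and Z: "finite Z" "Z \<subseteq> D" "\<And>z. z \<in> Z \<Longrightarrow> f z = \<zeta>"
  shows "\<exists>\<delta>>0. \<forall>\<zeta>'. 0 < dist \<zeta>' \<zeta> \<longrightarrow> dist \<zeta>' \<zeta> < \<delta> \<longrightarrow>
    (\<exists>W \<subseteq> D. finite W \<and> card W = (\<Sum>z\<in>Z. nat (zorder (\<lambda>w. f w - \<zeta>) z)) \<and> (\<forall>w\<in>W. f w = \<zeta>'))"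
proof -
  \<comment> \<open>Pairwise disjoint discs around the points of \<open>Z\<close>.\<close>
  have "\<exists>r>0. ball z r \<subseteq> D \<and> (\<forall>z'\<in>Z. z' \<noteq> z \<longrightarrow> 2 * r \<le> dist z z')" if "z \<in> Z" for z
  proof -
    obtain d where d: "d > 0" "\<And>z'. z' \<in> Z \<Longrightarrow> z' \<noteq> z \<Longrightarrow> d \<le> dist z z'"
      using finite_set_avoid[OF Z(1), of z] by blast
    obtain e where e: "e > 0" "ball z e \<subseteq> D"
      using \<open>open D\<close> Z(2) \<open>z \<in> Z\<close> by (meson open_contains_ball subsetD)
    show ?thesis
    proof (intro exI[of _ "min e (d/2)"] conjI ballI impI)
      show "0 < min e (d/2)" using d e by simp
      show "ball z (min e (d/2)) \<subseteq> D" using e(2) by auto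
      fix z' assume "z' \<in> Z" "z' \<noteq> z"
      then show "2 * min e (d/2) \<le> dist z z'" using d(2)[of z'] by simp
    qed
  qed
  then obtain r where r: "\<And>z. z \<in> Z \<Longrightarrow> 0 < r z" "\<And>z. z \<in> Z \<Longrightarrow> ball z (r z) \<subseteq> D"
    "\<And>z z'. z \<in> Z \<Longrightarrow> z' \<in> Z \<Longrightarrow> z' \<noteq> z \<Longrightarrow> 2 * r z \<le> dist z z'"
    by metis
  have disj: "ball z (r z) \<inter> ball z' (r z') = {}" if "z \<in> Z" "z' \<in> Z" "z \<noteq> z'" for z z'
  proof -
    have "r z + r z' \<le> dist z z'"
      using r(3)[of z z'] r(3)[of z' z] that by (simp add: dist_commute)
    then show ?thesis by (rule disjoint_ballI)
  qed
  have "\<exists>\<delta>>0. \<forall>\<zeta>'. 0 < dist \<zeta>' \<zeta> \<longrightarrow> dist \<zeta>' \<zeta> < \<delta> \<longrightarrow>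
      (\<exists>W \<subseteq> ball z (r z). finite W \<and> card W = nat (zorder (\<lambda>w. f w - \<zeta>) z) \<and> (\<forall>w\<in>W. f w = \<zeta>'))"
    if "z \<in> Z" for z
    using zorder_many_preimages[of f z "r z"] holomorphic_on_subset[OF holf r(2)]
      r(1) r(2) nonconst that Z(3) by metis
  then obtain \<delta> where \<delta>: "\<And>z. z \<in> Z \<Longrightarrow> 0 < \<delta> z"
    "\<And>z \<zeta>'. z \<in> Z \<Longrightarrow> 0 < dist \<zeta>' \<zeta> \<Longrightarrow> dist \<zeta>' \<zeta> < \<delta> z \<Longrightarrow>
      \<exists>W \<subseteq> ball z (r z). finite W \<and> card W = nat (zorder (\<lambda>w. f w - \<zeta>) z) \<and> (\<forall>w\<in>W. f w = \<zeta>')"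
    by metis
  define \<epsilon> where "\<epsilon> = Min (insert 1 (\<delta> ` Z))"
  show ?thesis
  proof (intro exI[of _ \<epsilon>] conjI allI impI)
    show "0 < \<epsilon>" unfolding \<epsilon>_def using Z(1) \<delta>(1) by (auto simp: Min_gr_iff)
  next
    fix \<zeta>' assume \<zeta>': "0 < dist \<zeta>' \<zeta>" "dist \<zeta>' \<zeta> < \<epsilon>"
    have "dist \<zeta>' \<zeta> < \<delta> z" if "z \<in> Z" for z
      using \<zeta>'(2) Z(1) that unfolding \<epsilon>_def by (auto simp: Min_gr_iff)
    then have "\<exists>W \<subseteq> ball z (r z). finite W \<and> card W = nat (zorder (\<lambda>w. f w - \<zeta>) z) \<and> (\<forall>w\<in>W. f w = \<zeta>')"
      if "z \<in> Z" for z
      using \<delta>(2) \<zeta>'(1) that by blast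
    then obtain W where W: "\<And>z. z \<in> Z \<Longrightarrow> W z \<subseteq> ball z (r z)" "\<And>z. z \<in> Z \<Longrightarrow> finite (W z)"
      "\<And>z. z \<in> Z \<Longrightarrow> card (W z) = nat (zorder (\<lambda>w. f w - \<zeta>) z)"
      "\<And>z w. z \<in> Z \<Longrightarrow> w \<in> W z \<Longrightarrow> f w = \<zeta>'"
      by metis
    show "\<exists>W \<subseteq> D. finite W \<and> card W = (\<Sum>z\<in>Z. nat (zorder (\<lambda>w. f w - \<zeta>) z)) \<and> (\<forall>w\<in>W. f w = \<zeta>')"
    proof (intro exI[of _ "\<Union>z\<in>Z. W z"] conjI ballI)
      show "(\<Union>z\<in>Z. W z) \<subseteq> D" using W(1) r(2) by blast
      show "finite (\<Union>z\<in>Z. W z)" using Z(1) W(2) by blast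
      have "card (\<Union>z\<in>Z. W z) = (\<Sum>z\<in>Z. card (W z))"
        using Z(1) W(1,2) disj by (intro card_UN_disjoint) blast+
      then show "card (\<Union>z\<in>Z. W z) = (\<Sum>z\<in>Z. nat (zorder (\<lambda>w. f w - \<zeta>) z))"
        using W(3) by simp
      show "f w = \<zeta>'" if "w \<in> (\<Union>z\<in>Z. W z)" for w using that W(4) by blast
    qed
  qed
qed

lemma num_solutions_leI:
  assumes "\<And>Z. finite Z \<Longrightarrow> Z \<subseteq> {z\<in>D. f z = \<zeta>} \<Longrightarrow>
    of_nat (\<Sum>z\<in>Z. nat (zorder (\<lambda>w. f w - \<zeta>) z)) \<le> B"
  shows "num_solutions f D \<zeta> \<le> B"
  unfolding num_solutions_def
proof (rule infsum_le_finite_sums)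
  show "(\<lambda>z. of_nat (nat (zorder (\<lambda>w. f w - \<zeta>) z)) :: ennreal) summable_on {z \<in> D. f z = \<zeta>}"
    by (rule nonneg_summable_on_complete) simp
  show "(\<Sum>z\<in>Z. of_nat (nat (zorder (\<lambda>w. f w - \<zeta>) z))) \<le> B"
    if "finite Z" "Z \<subseteq> {z \<in> D. f z = \<zeta>}" for Z
    using assms[OF that] by (simp only: of_nat_sum)
qed

section \<open>Polynomials with prescribed sign and partial fractions\<close>

text \<open>The polynomial has a simple zero exactly at those points of \<open>X\<close> where the sign of \<open>s\<close>
  flips, and it is found by scanning \<open>X\<close> from left to right. Only the points of \<open>D\<close> are tested;
  in the application the complement of \<open>D\<close> consists of a null set and of points where \<open>s\<close> vanishes.\<close>
lemma sign_polynomial: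
  fixes s :: "real \<Rightarrow> real"
  assumes "finite X" "D \<inter> X = {}"
    and "\<And>u v. u \<in> D \<Longrightarrow> v \<in> D \<Longrightarrow> u < v \<Longrightarrow> s u * s v < 0 \<Longrightarrow> \<exists>x\<in>X. u < x \<and> x < v"
  shows "\<exists>Y\<subseteq>X. \<exists>c\<in>{-1,1}. \<forall>u\<in>D. 0 \<le> c * (\<Prod>t\<in>Y. u - t) * s u"
  using assms
proof (induction X arbitrary: D rule: finite_linorder_max_induct)
  case empty
  have "(\<forall>u\<in>D. 0 \<le> s u) \<or> (\<forall>u\<in>D. s u \<le> 0)"
  proof (rule ccontr)
    assume "\<not> ?thesis"
    then obtain u v where "u \<in> D" "v \<in> D" "s u < 0" "0 < s v" by (meson not_le)
    moreover from this have "u \<noteq> v" "s u * s v < 0" "s v * s u < 0"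
      by (auto simp: mult_less_0_iff)
    ultimately show False using empty(2) by (metis empty_iff linorder_neqE)
  qed
  then show ?case by (intro exI[of _ "{}"]) auto
next
  case (insert m X)
  have "\<exists>Y\<subseteq>X. \<exists>c\<in>{-1,1}. \<forall>u\<in>D\<inter>{..<m}. 0 \<le> c * (\<Prod>t\<in>Y. u - t) * s u"
  proof (rule insert.IH)
    show "D \<inter> {..<m} \<inter> X = {}" using insert.prems by blast
    fix u v assume uv: "u \<in> D \<inter> {..<m}" "v \<in> D \<inter> {..<m}" "u < v" "s u * s v < 0"
    then obtain x where "x \<in> insert m X" "u < x" "x < v" using insert.prems(2) by blast
    then show "\<exists>x\<in>X. u < x \<and> x < v" using uv by auto
  qed
  then obtain Y c where Y: "Y \<subseteq> X" "c \<in> {-1,1}"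
    "\<And>u. u \<in> D \<Longrightarrow> u < m \<Longrightarrow> 0 \<le> c * (\<Prod>t\<in>Y. u - t) * s u" by blast
  have fY: "finite Y" using Y(1) insert.hyps(1) finite_subset by blast
  have mY: "m \<notin> Y" using Y(1) insert.hyps(2) by blast
  have pos: "0 < (\<Prod>t\<in>Y. u - t)" if "m < u" for u
    using that Y(1) insert.hyps(2) by (intro prod_pos) (fastforce)
  have "(\<forall>u\<in>D\<inter>{m<..}. 0 \<le> c * s u) \<or> (\<forall>u\<in>D\<inter>{m<..}. c * s u \<le> 0)"
  proof (rule ccontr)
    assume "\<not> ?thesis"
    then obtain u v where uv: "u \<in> D\<inter>{m<..}" "v \<in> D\<inter>{m<..}" "c * s u < 0" "0 < c * s v"
      by (meson not_le)
    then have "u \<noteq> v" "s u * s v < 0" "s v * s u < 0"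
      using Y(2) by (auto simp: mult_less_0_iff)
    then obtain x where "x \<in> insert m X" "min u v < x"
      using uv insert.prems(2)[of u v] insert.prems(2)[of v u] by (metis IntD1 linorder_neqE min.strict_coboundedI1 min.strict_coboundedI2)
    then show False using uv insert.hyps(2) by (auto simp: min_def split: if_splits)
  qed
  then show ?case
  proof
    assume A: "\<forall>u\<in>D\<inter>{m<..}. 0 \<le> c * s u"
    have "0 \<le> c * (\<Prod>t\<in>Y. u - t) * s u" if "u \<in> D" for u
    proof (cases "u < m")
      case False
      then have "m < u" using that insert.prems(1) by (metis disjoint_iff insertI1 linorder_neqE)
      then have "0 \<le> (\<Prod>t\<in>Y. u - t) * (c * s u)" using A pos[of u] that by auto
      then show ?thesis by (simp add: mult_ac)
    qed (use Y(3) that in blast)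
    then show ?thesis using Y(1,2) by blast
  next
    assume A: "\<forall>u\<in>D\<inter>{m<..}. c * s u \<le> 0"
    have "0 \<le> - c * (\<Prod>t\<in>insert m Y. u - t) * s u" if "u \<in> D" for u
    proof (cases "u < m")
      case True
      have "0 \<le> (m - u) * (c * (\<Prod>t\<in>Y. u - t) * s u)" using True Y(3) that by simp
      then show ?thesis using fY mY by (simp add: algebra_simps)
    next
      case False
      then have "m < u" using that insert.prems(1) by (metis disjoint_iff insertI1 linorder_neqE)
      then have "0 \<le> ((u - m) * (\<Prod>t\<in>Y. u - t)) * (- (c * s u))"
        using A pos[of u] that by (intro mult_nonneg_nonneg) auto
      then show ?thesis using fY mY by (simp add: algebra_simps)
    qed
    then show ?thesis using Y(1,2) by (intro exI[of _ "insert m Y"] conjI bexI[of _ "-c"]) auto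
  qed
qed

text \<open>A function that is negative near both ends of the line flips its sign an even number of
  times. The parity matters later: it upgrades the bound \<open>deg q < deg B\<close> for a quotient \<open>q / B\<close>
  with \<open>deg B\<close> even to \<open>deg q \<le> deg B - 2\<close>.\<close>
lemma even_sign_polynomial:
  fixes s :: "real \<Rightarrow> real"
  assumes X: "finite X" "D \<inter> X = {}"
    and sep: "\<And>u v. u \<in> D \<Longrightarrow> v \<in> D \<Longrightarrow> u < v \<Longrightarrow> s u * s v < 0 \<Longrightarrow> \<exists>x\<in>X. u < x \<and> x < v"
    and outer: "\<And>u. M < \<bar>u\<bar> \<Longrightarrow> u \<in> D \<and> s u < 0"
  shows "\<exists>Y\<subseteq>X. even (card Y) \<and> (\<forall>u\<in>D. (\<Prod>t\<in>Y. u - t) * s u \<le> 0)"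
proof -
  have "\<exists>Y\<subseteq>X. \<exists>c\<in>{-1,1}. \<forall>u\<in>D. 0 \<le> c * (\<Prod>t\<in>Y. u - t) * s u"
    using X sep by (rule sign_polynomial)
  then obtain Y c where Y: "Y \<subseteq> X" "c \<in> {-1,1}"
    "\<And>u. u \<in> D \<Longrightarrow> 0 \<le> c * (\<Prod>t\<in>Y. u - t) * s u"
    by blast
  have fY: "finite Y" using Y(1) X(1) finite_subset by blast
  define K where "K = Max (insert \<bar>M\<bar> (abs ` Y)) + 1"
  have "k < K" if "k \<in> insert \<bar>M\<bar> (abs ` Y)" for k
    using Max_ge[OF _ that] fY unfolding K_def by simp
  then have K: "\<bar>M\<bar> < K" "\<And>t. t \<in> Y \<Longrightarrow> \<bar>t\<bar> < K" by auto
  have out: "K \<in> D" "s K < 0" "-K \<in> D" "s (-K) < 0"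
    using outer[of K] outer[of "-K"] K(1) by auto
  have pos: "0 < (\<Prod>t\<in>Y. K - t)" "0 < (\<Prod>t\<in>Y. K + t)"
    using K(2) by (force intro!: prod_pos simp: abs_less_iff)+
  have "c \<noteq> 1"
  proof
    assume "c = 1"
    with Y(3)[OF out(1)] have "0 \<le> (\<Prod>t\<in>Y. K - t) * s K" by simp
    then show False using pos(1) out(2) by (simp add: zero_le_mult_iff)
  qed
  then have c: "c = -1" using Y(2) by auto
  have "(\<Prod>t\<in>Y. - K - t) = (\<Prod>t\<in>Y. (-1) * (K + t))" by (intro prod.cong) auto
  also have "\<dots> = (-1) ^ card Y * (\<Prod>t\<in>Y. K + t)" by (simp only: prod.distrib prod_constant)
  finally have "0 \<le> c * ((-1) ^ card Y * (\<Prod>t\<in>Y. K + t)) * s (-K)"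
    using Y(3)[OF out(3)] by simp
  then have "even (card Y)"
    using c pos(2) out(4) by (cases "even (card Y)") (auto simp: zero_le_mult_iff mult_le_0_iff)
  then show ?thesis using Y c by (intro exI[of _ Y]) auto
qed

text \<open>Lagrange interpolation at the nodes \<open>W\<close>, divided by the node polynomial. The sum of the
  residues is the coefficient just below the degree of the denominator, hence it vanishes if the
  quotient decays like \<open>1 / x\<^sup>2\<close>.\<close>
lemma partial_fractions:
  fixes q :: "'a::field poly"
  assumes W: "finite W" and q: "degree q < card W" 
  defines "c \<equiv> \<lambda>w. poly q w / (\<Prod>v\<in>W - {w}. w - v)"
  shows "x \<notin> W \<Longrightarrow> poly q x / (\<Prod>w\<in>W. x - w) = (\<Sum>w\<in>W. c w / (x - w))"
    and "(\<Sum>w\<in>W. c w) = poly.coeff q (card W - 1)"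
proof -
  define L where "L w = (\<Prod>v\<in>W - {w}. [:-v, 1:])" for w
  define P where "P = (\<Sum>w\<in>W. smult (c w) (L w))"
  have Lx: "poly (L w) x = (\<Prod>v\<in>W - {w}. x - v)" for w x
    by (simp add: L_def poly_prod)
  have dL: "degree (L w) = card W - 1" if "w \<in> W" for w
    unfolding L_def using that W by (subst degree_prod_sum_eq) auto
  have lL: "poly.coeff (L w) (card W - 1) = 1" if "w \<in> W" for w
    using lead_coeff_prod[of "\<lambda>v. [:-v, 1:]" "W - {w}"] dL[OF that] by (simp add: L_def)
  have "q = P"
  proof (rule poly_eqI_degree[of W])
    fix w assume w: "w \<in> W"
    have "poly P w = (\<Sum>v\<in>W. c v * (\<Prod>u\<in>W - {v}. w - u))" by (simp add: P_def poly_sum Lx)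
    also have "\<dots> = (\<Sum>v\<in>W. if v = w then c w * (\<Prod>u\<in>W - {w}. w - u) else 0)"
      using w W by (intro sum.cong refl) (auto intro!: prod_zero)
    also have "\<dots> = poly q w" using w W by (simp add: c_def)
    finally show "poly q w = poly P w" ..
  next
    have "degree P \<le> card W - 1"
      unfolding P_def using dL
      by (intro degree_sum_le W) (metis degree_smult_le)
    then show "degree P < card W" using q by simp
  qed (use q in simp)
  show "(\<Sum>w\<in>W. c w) = poly.coeff q (card W - 1)"
    using arg_cong[OF \<open>q = P\<close>, of "\<lambda>p. poly.coeff p (card W - 1)"] lL
    by (simp add: P_def coeff_sum)
  assume x: "x \<notin> W"
  have nz: "(\<Prod>w\<in>W. x - w) \<noteq> 0" using x W by auto
  have "poly q x = (\<Sum>w\<in>W. c w * (\<Prod>u\<in>W - {w}. x - u))"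
    using arg_cong[OF \<open>q = P\<close>, of "\<lambda>p. poly p x"] by (simp add: P_def poly_sum Lx)
  also have "\<dots> = (\<Sum>w\<in>W. c w / (x - w) * (\<Prod>u\<in>W. x - u))"
    using x W by (intro sum.cong refl) (auto simp: prod.remove)
  finally show "poly q x / (\<Prod>w\<in>W. x - w) = (\<Sum>w\<in>W. c w / (x - w))"
    using nz by (simp add: nonzero_divide_eq_eq sum_distrib_right)
qed

section \<open>Sign changes of the density bound the number of solutions\<close>

lemma set_integrable_Cauchy_kernel:
  assumes "Im w \<noteq> 0"
  shows "set_integrable lborel {a..b} (\<lambda>x. 1 / (complex_of_real x - w))"
  using assms by (intro borel_integrable_atLeastAtMost' continuous_intros) (auto simp: complex_eq_iff)

text \<open>The principal value of the Cauchy kernel. For \<open>w\<close> in the upper half plane \<open>x - w\<close> avoids the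
  cut of the logarithm, so \<open>Ln (x - w)\<close> is a primitive; its argument runs from \<open>-\<pi>\<close> to \<open>0\<close> while its
  modulus contributes nothing over symmetric intervals.\<close>
lemma tendsto_integral_Cauchy_kernel_upper:
  assumes w: "0 < Im w"
  shows "((\<lambda>T. LINT x:{-T..T}|lborel. 1 / (complex_of_real x - w)) \<longlongrightarrow> \<i> * pi) at_top"
proof -
  have "\<forall>\<^sub>F T in at_top. (LINT x:{-T..T}|lborel. 1 / (complex_of_real x - w)) =
    Ln (1 - w / of_real T) - Ln (1 + w / of_real T) + \<i> * pi"
  proof (rule eventually_at_top_linorderI)
    fix T :: real assume T: "1 \<le> T"
    have "(LINT x:{-T..T}|lborel. 1 / (complex_of_real x - w)) = Ln (of_real T - w) - Ln (of_real (- T) - w)"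
      unfolding set_lebesgue_integral_def
    proof (rule integral_FTC_atLeastAtMost)
      show "continuous_on {-T..T} (\<lambda>x. 1 / (complex_of_real x - w))"
        using w by (intro continuous_intros) (auto simp: complex_eq_iff)
      fix x :: real
      have "complex_of_real x - w \<notin> \<real>\<^sub>\<le>\<^sub>0" using w by (auto simp: complex_nonpos_Reals_iff)
      then have "(Ln has_field_derivative 1 / (complex_of_real x - w)) (at (of_real x - w))"
        by (metis has_field_derivative_Ln inverse_eq_divide)
      moreover have "((\<lambda>x. complex_of_real x - w) has_vector_derivative 1) (at x within {-T..T})"
        by (auto intro!: derivative_eq_intros)
      ultimately show "((\<lambda>x. Ln (of_real x - w)) has_vector_derivative 1 / (complex_of_real x - w)) (at x within {-T..T})"
        using field_vector_diff_chain_within[of "\<lambda>x. complex_of_real x - w" 1 x "{-T..T}" Ln "1 / (complex_of_real x - w)"]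
        by (simp add: o_def has_field_derivative_at_within)
    qed (use T in auto)
    also have "of_real T - w = of_real T * (1 - w / of_real T)" using T by (simp add: field_simps)
    also have "Ln \<dots> = ln T + Ln (1 - w / of_real T)"
      using T w by (subst Ln_times_of_real) (auto simp: complex_eq_iff Im_divide_of_real)
    also have "of_real (- T) - w = - (of_real T + w)" by simp
    also have "Ln \<dots> = Ln (of_real T + w) - \<i> * pi"
      using w by (subst Ln_minus) (auto simp: complex_eq_iff)
    also have "of_real T + w = of_real T * (1 + w / of_real T)" using T by (simp add: field_simps)
    also have "Ln \<dots> = ln T + Ln (1 + w / of_real T)"
      using T w by (subst Ln_times_of_real) (auto simp: complex_eq_iff Im_divide_of_real)
    finally show "(LINT x:{-T..T}|lborel. 1 / (complex_of_real x - w)) =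
      Ln (1 - w / of_real T) - Ln (1 + w / of_real T) + \<i> * pi" by simp
  qed
  moreover have "((\<lambda>T. Ln (1 - w / of_real T) - Ln (1 + w / of_real T) + \<i> * pi) \<longlongrightarrow>
    Ln (1 - 0) - Ln (1 + 0) + \<i> * pi) at_top"
  proof -
    have "((\<lambda>T::real. w / of_real T) \<longlongrightarrow> 0) at_top"
      using tendsto_mult[OF tendsto_const[of w] tendsto_of_real[OF tendsto_inverse_0_at_top[OF filterlim_ident]]]
      by (simp add: field_simps)
    then show ?thesis by (intro tendsto_intros) auto
  qed
  ultimately show ?thesis by (simp add: filterlim_cong)
qed

lemma tendsto_integral_Cauchy_kernel:
  assumes w: "Im w \<noteq> 0"
  shows "((\<lambda>T. LINT x:{-T..T}|lborel. 1 / (complex_of_real x - w)) \<longlongrightarrow> \<i> * pi * sgn (Im w)) at_top"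
proof (cases "0 < Im w")
  case True
  then show ?thesis using tendsto_integral_Cauchy_kernel_upper by simp
next
  case False
  have eq: "cnj (LINT x:{-T..T}|lborel. 1 / (complex_of_real x - cnj w)) = (LINT x:{-T..T}|lborel. 1 / (complex_of_real x - w))" for T :: real
    unfolding set_lebesgue_integral_def Bochner_Integration.integral_cnj[symmetric]
    by (intro Bochner_Integration.integral_cong refl) simp
  have "((\<lambda>T. cnj (LINT x:{-T..T}|lborel. 1 / (complex_of_real x - cnj w))) \<longlongrightarrow> cnj (\<i> * pi)) at_top"
    using False w by (intro tendsto_cnj tendsto_integral_Cauchy_kernel_upper) auto
  then show ?thesis using False w by (simp add: eq sgn_if)
qed

lemma integrable_Cauchy_kernel:
  fixes \<rho> :: "real \<Rightarrow> real"
  assumes "integrable lborel \<rho>" "Im w \<noteq> 0"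
  shows "integrable lborel (\<lambda>x. complex_of_real (\<rho> x) / (of_real x - w))"
proof (rule Bochner_Integration.integrable_bound)
  show "integrable lborel (\<lambda>x. \<rho> x / \<bar>Im w\<bar>)" using assms(1) by simp
  show "(\<lambda>x. complex_of_real (\<rho> x) / (of_real x - w)) \<in> borel_measurable lborel"
    using assms(1) by measurable
  have "\<bar>Im w\<bar> \<le> norm (complex_of_real x - w)" for x
    using abs_Im_le_cmod[of "complex_of_real x - w"] by simp
  then show "AE x in lborel. norm (complex_of_real (\<rho> x) / (of_real x - w)) \<le> norm (\<rho> x / \<bar>Im w\<bar>)"
    using assms(2) by (intro AE_I2) (auto simp: norm_divide intro!: divide_left_mono mult_pos_pos)
qed

text \<open>The main estimate. Suppose that the number \<open>m\<close> of solutions satisfies \<open>2 m > card Y\<close>, and let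
  \<open>R x = (\<Prod>t\<in>Y. x - t) / (\<Prod>z\<in>Z. \<bar>x - z\<bar>\<^sup>2)\<close>, a real function with simple poles at the solutions and
  their conjugates, whose residues \<open>c\<^sub>w\<close> add up to \<open>0\<close>. The integral of \<open>(\<rho> x - y) / (x - w)\<close> over
  \<open>[-T, T]\<close> consists of the negative of the Stieltjes transform at \<open>w\<close> and of \<open>-y\<close> times the
  principal value \<open>\<plusminus>\<i>\<pi>\<close>. As \<open>Im \<zeta> = - \<pi> y\<close>, the imaginary parts cancel and the limit is
  \<open>- Re \<zeta>\<close> at every pole \<open>w\<close>, so the integrals of \<open>(\<rho> - y) R\<close> tend to \<open>- Re \<zeta> (\<Sum>w. c\<^sub>w) = 0\<close>. But
  \<open>(\<rho> - y) R\<close> does not change sign, and it is not zero far out, where \<open>\<rho>\<close> vanishes.\<close>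
lemma level_crossings_bound_zeros:
  fixes \<rho> :: "real \<Rightarrow> real"
  assumes int: "integrable lborel \<rho>" and supp: "\<And>x. M < \<bar>x\<bar> \<Longrightarrow> \<rho> x = 0"
    and y: "0 < y" "Im \<zeta> = - pi * y"
    and Z: "finite Z" "\<And>z. z \<in> Z \<Longrightarrow> 0 < Im z"
      "\<And>z. z \<in> Z \<Longrightarrow> (LINT x|lborel. complex_of_real (\<rho> x) / (z - of_real x)) = \<zeta>"
    and Y: "finite Y" "even (card Y)"
      "AE x in lborel. (\<Prod>t\<in>Y. x - t) * (\<rho> x - y) \<le> 0"
  shows "2 * card Z \<le> card Y"
proof (rule ccontr)
  assume "\<not> 2 * card Z \<le> card Y"
  then have less: "card Y + 2 \<le> 2 * card Z" using Y(2) by presburger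
  define W where "W = Z \<union> cnj ` Z"
  have ZW: "Z \<inter> cnj ` Z = {}"
  proof -
    have False if "z \<in> Z" "cnj z \<in> Z" for z using Z(2)[OF that(1)] Z(2)[OF that(2)] by simp
    then show ?thesis by auto
  qed
  have fW: "finite W" using Z(1) by (simp add: W_def)
  have ImW: "Im w \<noteq> 0" if "w \<in> W" for w using that Z(2) unfolding W_def by fastforce
  have cW: "card W = 2 * card Z"
    unfolding W_def using ZW Z(1) by (subst card_Un_disjoint) (auto simp: card_image inj_on_def)
  define q where "q = (\<Prod>t\<in>Y. [:- complex_of_real t, 1:])"
  have dq: "degree q = card Y" unfolding q_def by (subst degree_prod_sum_eq) auto
  have qx: "poly q (of_real x) = of_real (\<Prod>t\<in>Y. x - t)" for x
    by (simp add: q_def poly_prod)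
  define c where "c w = poly q w / (\<Prod>v\<in>W - {w}. w - v)" for w
  have dqW: "degree q < card W" using less by (simp add: dq cW)
  have sumc: "(\<Sum>w\<in>W. c w) = 0"
    unfolding c_def using partial_fractions(2)[OF fW dqW] less
    by (simp add: coeff_eq_0 dq cW)
  define B where "B x = (\<Prod>z\<in>Z. (cmod (of_real x - z))\<^sup>2)" for x :: real
  have Bpos: "0 < B x" for x unfolding B_def
    using Z(2) by (intro prod_pos) (force simp: complex_eq_iff)
  have BW: "(\<Prod>w\<in>W. of_real x - w) = complex_of_real (B x)" for x
  proof -
    have "(\<Prod>w\<in>W. of_real x - w) = (\<Prod>z\<in>Z. complex_of_real x - z) * (\<Prod>z\<in>Z. of_real x - cnj z)"
      unfolding W_def using Z(1) ZW
      by (subst prod.union_disjoint) (auto simp: prod.reindex inj_on_def)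
    also have "\<dots> = (\<Prod>z\<in>Z. complex_of_real ((cmod (of_real x - z))\<^sup>2))"
      unfolding prod.distrib[symmetric] by (intro prod.cong refl) (simp add: complex_norm_square del: of_real_power)
    finally show ?thesis by (simp add: B_def)
  qed
  define g where "g x = (\<rho> x - y) * (\<Prod>t\<in>Y. x - t) / B x" for x
  \<comment> \<open>One summand of \<open>(\<rho> - y) R\<close> in its partial fraction expansion, without its residue.\<close>
  define k where "k w x = complex_of_real (\<rho> x - y) * (1 / (of_real x - w))" for w x
  have g_eq: "complex_of_real (g x) = (\<Sum>w\<in>W. c w * k w x)" for x
  proof -
    have "complex_of_real x \<notin> W" using ImW by force
    from partial_fractions(1)[OF fW dqW this]
    have "of_real ((\<Prod>t\<in>Y. x - t) / B x) = (\<Sum>w\<in>W. c w / (complex_of_real x - w))"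
      unfolding c_def BW qx by simp
    moreover have "complex_of_real (g x) = of_real (\<rho> x - y) * of_real ((\<Prod>t\<in>Y. x - t) / B x)"
      by (simp add: g_def)
    ultimately show ?thesis by (simp add: k_def sum_distrib_left mult_ac)
  qed
  have int\<rho>: "set_integrable lborel A (\<lambda>x. complex_of_real (\<rho> x) / (of_real x - w))"
    if "w \<in> W" "A \<in> sets borel" for w A
    unfolding set_integrable_def
    using integrable_mult_indicator[OF _ integrable_Cauchy_kernel[OF int ImW[OF that(1)]]] that(2) by simp
  have k_eq: "k w x = complex_of_real (\<rho> x) / (of_real x - w) - of_real y * (1 / (of_real x - w))" for w x
    by (simp add: k_def diff_divide_distrib)
  have intk: "set_integrable lborel {-T..T} (k w)" if "w \<in> W" for w T
    unfolding k_eq[abs_def]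
    by (intro set_integral_diff(1) int\<rho> set_integrable_mult_right set_integrable_Cauchy_kernel that ImW) auto
  have lim_k: "((\<lambda>T. LINT x:{-T..T}|lborel. k w x) \<longlongrightarrow> - of_real (Re \<zeta>)) at_top" if w: "w \<in> W" for w
  proof -
    define H where "H = (LINT x|lborel. complex_of_real (\<rho> x) / (of_real x - w))"
    have H: "H = - of_real (Re \<zeta>) + \<i> * of_real (pi * y * sgn (Im w))"
    proof (cases "w \<in> Z")
      case True
      have "H = (LINT x|lborel. - (complex_of_real (\<rho> x) / (w - of_real x)))"
        unfolding H_def by (intro Bochner_Integration.integral_cong refl) (metis minus_diff_eq minus_divide_right)
      then have "H = - \<zeta>" using Z(3)[OF True] by simp
      then show ?thesis using Z(2)[OF True] y(2) by (simp add: complex_eq_iff)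
    next
      case False
      then obtain z where z: "z \<in> Z" "w = cnj z" using w by (auto simp: W_def)
      have "H = (LINT x|lborel. - cnj (complex_of_real (\<rho> x) / (z - of_real x)))"
        unfolding H_def z(2) by (intro Bochner_Integration.integral_cong refl)
          (simp, metis minus_diff_eq minus_divide_right)
      then have "H = - cnj \<zeta>" using Z(3)[OF z(1)] by (simp del: complex_cnj_divide)
      then show ?thesis using Z(2)[OF z(1)] y(2) z(2) by (simp add: complex_eq_iff)
    qed
    have "\<forall>\<^sub>F T in at_top. (LINT x:{-T..T}|lborel. k w x) =
      H - of_real y * (LINT x:{-T..T}|lborel. 1 / (complex_of_real x - w))"
    proof (rule eventually_at_top_linorderI)
      fix T assume T: "M \<le> T"
      have "(LINT x:{-T..T}|lborel. complex_of_real (\<rho> x) / (of_real x - w)) = H"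
        unfolding H_def set_lebesgue_integral_def using supp T
        by (intro Bochner_Integration.integral_cong refl) (auto simp: indicator_def abs_less_iff)
      moreover have "(LINT x:{-T..T}|lborel. k w x) = (LINT x:{-T..T}|lborel. complex_of_real (\<rho> x) / (of_real x - w))
          - (LINT x:{-T..T}|lborel. of_real y * (1 / (complex_of_real x - w)))"
        unfolding k_eq
        by (intro set_integral_diff(2) int\<rho> set_integrable_mult_right set_integrable_Cauchy_kernel w ImW) auto
      ultimately show "(LINT x:{-T..T}|lborel. k w x) =
          H - of_real y * (LINT x:{-T..T}|lborel. 1 / (complex_of_real x - w))"
        by (simp only: set_integral_mult_right)
    qed
    moreover have "((\<lambda>T. H - of_real y * (LINT x:{-T..T}|lborel. 1 / (complex_of_real x - w))) \<longlongrightarrow>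
        H - of_real y * (\<i> * pi * sgn (Im w))) at_top"
      by (intro tendsto_intros tendsto_integral_Cauchy_kernel ImW w)
    moreover have "H - of_real y * (\<i> * pi * sgn (Im w)) = - of_real (Re \<zeta>)"
      unfolding H by simp
    ultimately show ?thesis by (simp add: filterlim_cong)
  qed
  define J where "J T = (LINT x:{-T..T}|lborel. g x)" for T
  have intg: "set_integrable lborel {-T..T} g" for T
  proof -
    have "set_integrable lborel {-T..T} (\<lambda>x. complex_of_real (g x))"
      using set_integrable_mult_right[OF intk]
      unfolding g_eq set_integrable_def scaleR_sum_right
      by (intro Bochner_Integration.integrable_sum) auto
    then have "integrable lborel (\<lambda>x. Re (indicator {-T..T} x *\<^sub>R complex_of_real (g x)))"
      unfolding set_integrable_def by (rule integrable_Re)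
    then show ?thesis by (simp add: set_integrable_def)
  qed
  have J_eq: "complex_of_real (J T) = (\<Sum>w\<in>W. c w * (LINT x:{-T..T}|lborel. k w x))" for T
  proof -
    have "complex_of_real (J T) = (LINT x:{-T..T}|lborel. complex_of_real (g x))"
      unfolding J_def by (rule set_integral_complex_of_real[symmetric])
    also have "\<dots> = (\<Sum>w\<in>W. (LINT x:{-T..T}|lborel. c w * k w x))"
      unfolding g_eq set_lebesgue_integral_def scaleR_sum_right
      using set_integrable_mult_right[OF intk] unfolding set_integrable_def
      by (intro Bochner_Integration.integral_sum) auto
    finally show ?thesis by simp
  qed
  have "((\<lambda>T. complex_of_real (J T)) \<longlongrightarrow> (\<Sum>w\<in>W. c w * (- of_real (Re \<zeta>)))) at_top"
    unfolding J_eq by (intro tendsto_intros lim_k)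
  then have "((\<lambda>T. complex_of_real (J T)) \<longlongrightarrow> of_real 0) at_top"
    by (simp only: sum_distrib_right[symmetric] sumc) simp
  then have limJ: "(J \<longlongrightarrow> 0) at_top" by (simp only: tendsto_of_real_iff)
  have g_neg: "AE x in lborel. g x \<le> 0"
    using Y(3) by eventually_elim (use Bpos in \<open>simp add: g_def divide_nonpos_pos mult.commute\<close>)
  have J_mono: "J T' \<le> J T" if "T \<le> T'" for T T'
    unfolding J_def set_lebesgue_integral_def
    using intg g_neg that unfolding set_integrable_def
    by (intro integral_mono_AE) (auto simp: indicator_def elim!: eventually_mono)
  \<comment> \<open>The function \<open>J\<close> decreases to \<open>0\<close>, yet its integrand is nonpositive.\<close>
  have J_nonneg: "0 \<le> J T" for T
    using limJ by (rule tendsto_upperbound[of J 0 at_top "J T"])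
       (auto intro!: eventually_at_top_linorderI[of T] J_mono)
  define K where "K = Max (insert \<bar>M\<bar> (abs ` Y))"
  have K: "\<bar>M\<bar> \<le> K" "\<And>t. t \<in> Y \<Longrightarrow> t \<le> K"
  proof -
    have "k \<le> K" if "k \<in> insert \<bar>M\<bar> (abs ` Y)" for k
      unfolding K_def using Y(1) that by (intro Max_ge) auto
    then show "\<bar>M\<bar> \<le> K" "\<And>t. t \<in> Y \<Longrightarrow> t \<le> K"
      by (auto intro: order_trans[OF abs_ge_self])
  qed
  have "(LINT x:{-(K+1)..K+1}|lborel. - g x) = 0"
  proof (rule antisym)
    have "(LINT x:{-(K+1)..K+1}|lborel. - g x) = - J (K+1)"
      unfolding J_def set_lebesgue_integral_def by simp
    then show "(LINT x:{-(K+1)..K+1}|lborel. - g x) \<le> 0" using J_nonneg by simp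
    show "0 \<le> (LINT x:{-(K+1)..K+1}|lborel. - g x)"
      unfolding set_lebesgue_integral_def using g_neg
      by (intro integral_nonneg_AE) (auto simp: indicator_def elim!: eventually_mono)
  qed
  then have "AE x in lborel. indicator {-(K+1)..K+1} x *\<^sub>R (- g x) = 0"
    unfolding set_lebesgue_integral_def
    using intg[of "K+1"] g_neg unfolding set_integrable_def
    by (subst (asm) integral_nonneg_eq_0_iff_AE) (auto simp: indicator_def elim!: eventually_mono)
  moreover have "g x \<noteq> 0" if "x \<in> {K<..<K+1}" for x
  proof -
    have "0 < (\<Prod>t\<in>Y. x - t)" using K(2) that by (intro prod_pos) force
    moreover have "\<rho> x = 0" using K(1) that by (intro supp) auto
    ultimately show ?thesis using Bpos[of x] y(1) by (simp add: g_def)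
  qed
  \<comment> \<open>The integrand vanishes almost everywhere on \<open>[-(K+1), K+1]\<close> but nowhere on \<open>(K, K+1)\<close>.\<close>
  ultimately have "AE x in lborel. x \<notin> {K<..<K+1}"
    using K(1) by (auto simp: indicator_def elim!: eventually_mono)
  then have "{K<..<K+1} \<in> null_sets lborel" 
    by (subst AE_iff_null_sets) auto
  then show False by (auto simp: null_sets_def)
qed

section \<open>The Stieltjes transform off the support\<close>

lemma closed_measure_support: "closed (measure_support \<mu>)"
proof -
  have "- measure_support \<mu> = \<Union>{U. open U \<and> emeasure \<mu> U = 0}"
    by (auto simp: measure_support_def)
  then show ?thesis by (auto simp: closed_def intro!: open_Union)
qed

text \<open>The complement of the support is a union of open null sets; by the Lindelof property
  countably many of them suffice.\<close>
lemma AE_in_measure_support: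
  assumes "sets \<mu> = sets borel"
  shows "AE x in \<mu>. x \<in> measure_support \<mu>"
proof -
  define \<U> where "\<U> = {U. open U \<and> emeasure \<mu> U = 0}"
  obtain \<V> where V: "\<V> \<subseteq> \<U>" "countable \<V>" "\<Union>\<V> = \<Union>\<U>"
    using Lindelof[of \<U>] unfolding \<U>_def by blast
  have "(\<Union>U\<in>\<V>. U) \<in> null_sets \<mu>"
    using V(1,2) assms by (intro null_sets_UN') (auto simp: \<U>_def null_sets_def)
  then have "\<Union>\<U> \<in> null_sets \<mu>" using V(3) by simp
  then show ?thesis
    by (rule AE_I') (auto simp: measure_support_def \<U>_def)
qed

lemma open_stieltjes_domain: "open (UNIV - complex_of_real ` measure_support \<mu>)"
proof -
  have "complex_of_real ` measure_support \<mu> = {z. Im z = 0} \<inter> Re -` measure_support \<mu>"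
    by (auto simp: image_iff complex_eq_iff intro!: bexI)
  moreover have "closed ({z. Im z = 0} \<inter> Re -` measure_support \<mu>)"
    by (intro closed_Int closed_vimage closed_measure_support continuous_intros closed_Collect_eq)
  ultimately show ?thesis by (simp add: open_Diff)
qed

text \<open>A uniform lower bound for the denominators near \<open>z\<close>, which serves as the dominating constant
  for the integrals below. It covers non-real points and real points in gaps of the support alike.\<close>
lemma stieltjes_domain_gap:
  assumes "z \<in> UNIV - complex_of_real ` measure_support \<mu>"
  obtains r where "0 < r" "\<And>w x. w \<in> ball z r \<Longrightarrow> x \<in> measure_support \<mu> \<Longrightarrow> r \<le> cmod (w - of_real x)"
proof -
  obtain e where e: "0 < e" "ball z e \<subseteq> UNIV - complex_of_real ` measure_support \<mu>"
    using open_stieltjes_domain assms by (meson open_contains_ball)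
  show thesis
  proof
    show "0 < e/2" using e by simp
    fix w x assume w: "w \<in> ball z (e/2)" and x: "x \<in> measure_support \<mu>"
    have "e \<le> cmod (z - of_real x)"
      using e(2) x by (force simp: dist_norm not_less[symmetric])
    also have "\<dots> \<le> cmod (z - w) + cmod (w - of_real x)" by (rule norm_diff_triangle_le[OF order_refl order_refl])
    finally show "e/2 \<le> cmod (w - of_real x)" using w by (simp add: dist_norm)
  qed
qed

context
  fixes \<mu> :: "real measure"
  assumes sets_\<mu>: "sets \<mu> = sets borel" and finite_\<mu>: "finite_measure \<mu>"
begin

interpretation finite_measure \<mu> by (rule finite_\<mu>)

lemma borel_measurable_stieltjes_kernel: "(\<lambda>x. 1 / (w - complex_of_real x)) \<in> borel_measurable \<mu>"
  unfolding measurable_cong_sets[OF sets_\<mu> refl] by measurable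

lemma integrable_stieltjes_kernel:
  assumes "w \<in> UNIV - complex_of_real ` measure_support \<mu>"
  shows "integrable \<mu> (\<lambda>x. 1 / (w - complex_of_real x))"
proof -
  obtain r where r: "0 < r" "\<And>v x. v \<in> ball w r \<Longrightarrow> x \<in> measure_support \<mu> \<Longrightarrow> r \<le> cmod (v - of_real x)"
    using stieltjes_domain_gap[OF assms] by blast
  have "AE x in \<mu>. cmod (1 / (w - complex_of_real x)) \<le> 1 / r"
    using AE_in_measure_support[OF sets_\<mu>]
  proof eventually_elim
    case (elim x)
    then have "r \<le> cmod (w - of_real x)" using r by simp
    then show ?case using r(1) by (simp add: norm_divide frac_le)
  qed
  then show ?thesis by (intro integrable_const_bound borel_measurable_stieltjes_kernel)
qed

lemma holomorphic_stieltjes_transform: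
  "stieltjes_transform \<mu> holomorphic_on (UNIV - complex_of_real ` measure_support \<mu>)"
  unfolding holomorphic_on_def
proof
  let ?D = "UNIV - complex_of_real ` measure_support \<mu>"
  fix z assume z: "z \<in> ?D"
  obtain r where r: "0 < r" "\<And>v x. v \<in> ball z r \<Longrightarrow> x \<in> measure_support \<mu> \<Longrightarrow> r \<le> cmod (v - of_real x)"
    using stieltjes_domain_gap[OF z] by blast
  have D: "w \<in> ?D" if "w \<in> ball z r" for w
  proof -
    have "w \<noteq> of_real x" if "x \<in> measure_support \<mu>" for x
      using r(2)[OF \<open>w \<in> ball z r\<close> that] r(1) by auto
    then show ?thesis by auto
  qed
  have zr: "z \<in> ball z r" using r(1) by simp
  let ?G' = "LINT x|\<mu>. - (1 / ((z - complex_of_real x) * (z - complex_of_real x)))"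
  have "((\<lambda>w. (stieltjes_transform \<mu> w - stieltjes_transform \<mu> z) / (w - z)) \<longlongrightarrow> ?G') (at z within ball z r)"
    unfolding tendsto_at_iff_sequentially
  proof (intro allI impI)
    fix X assume X: "\<forall>i. X i \<in> ball z r - {z}" "X \<longlonglongrightarrow> z"
    have eq: "((\<lambda>w. (stieltjes_transform \<mu> w - stieltjes_transform \<mu> z) / (w - z)) \<circ> X) i =
        (LINT x|\<mu>. - (1 / ((X i - complex_of_real x) * (z - complex_of_real x))))" for i
    proof -
      have Xi: "X i \<in> ball z r" "X i \<noteq> z" using X(1) by auto
      have "(stieltjes_transform \<mu> (X i) - stieltjes_transform \<mu> z) / (X i - z) =
          (LINT x|\<mu>. (1 / (X i - complex_of_real x) - 1 / (z - complex_of_real x)) / (X i - z))"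
        unfolding stieltjes_transform_def
        using integrable_stieltjes_kernel[OF D[OF Xi(1)]] integrable_stieltjes_kernel[OF z] by simp
      also have "\<dots> = (LINT x|\<mu>. - (1 / ((X i - complex_of_real x) * (z - complex_of_real x))))"
      proof (rule integral_cong_AE)
        show "AE x in \<mu>. (1 / (X i - complex_of_real x) - 1 / (z - complex_of_real x)) / (X i - z) =
            - (1 / ((X i - complex_of_real x) * (z - complex_of_real x)))"
          using AE_in_measure_support[OF sets_\<mu>]
        proof eventually_elim
          case (elim x)
          then have "X i - of_real x \<noteq> 0" "z - of_real x \<noteq> 0" "X i - z \<noteq> 0"
            using r(2)[OF Xi(1) elim] r(2)[OF zr elim] r(1) Xi(2) by auto
          then show ?case by (simp add: divide_simps)
        qed
      qed (unfold measurable_cong_sets[OF sets_\<mu> refl], measurable)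
      finally show ?thesis by simp
    qed
    have "(\<lambda>i. LINT x|\<mu>. - (1 / ((X i - complex_of_real x) * (z - complex_of_real x)))) \<longlonglongrightarrow> ?G'"
    proof (rule integral_dominated_convergence[where w = "\<lambda>_. 1 / (r * r)"])
      show "AE x in \<mu>. (\<lambda>i. - (1 / ((X i - complex_of_real x) * (z - complex_of_real x)))) \<longlonglongrightarrow>
          - (1 / ((z - complex_of_real x) * (z - complex_of_real x)))"
        using AE_in_measure_support[OF sets_\<mu>]
      proof eventually_elim
        case (elim x)
        then have "z - of_real x \<noteq> 0" using r(2)[OF zr elim] r(1) by auto
        then show ?case by (intro tendsto_intros X(2)) auto
      qed
      show "AE x in \<mu>. cmod (- (1 / ((X i - complex_of_real x) * (z - complex_of_real x)))) \<le> 1 / (r * r)" for i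
        using AE_in_measure_support[OF sets_\<mu>]
      proof eventually_elim
        case (elim x)
        have "r * r \<le> cmod (X i - of_real x) * cmod (z - of_real x)"
          using r(2)[OF _ elim, of "X i"] r(2)[OF zr elim] r(1) X(1) by (intro mult_mono) auto
        then show ?case using r(1) by (simp add: norm_divide norm_mult frac_le)
      qed
    qed (unfold measurable_cong_sets[OF sets_\<mu> refl], measurable)
    then show "((\<lambda>w. (stieltjes_transform \<mu> w - stieltjes_transform \<mu> z) / (w - z)) \<circ> X) \<longlonglongrightarrow> ?G'"
      unfolding eq[abs_def, symmetric] by (simp add: o_def)
  qed
  then have "(stieltjes_transform \<mu> has_field_derivative ?G') (at z within ball z r)"
    by (simp add: has_field_derivative_iff)
  then have "(stieltjes_transform \<mu> has_field_derivative ?G') (at z)"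
    by (simp only: at_within_open[OF zr open_ball])
  then show "stieltjes_transform \<mu> field_differentiable at z within ?D"
    by (metis field_differentiable_at_within field_differentiable_def)
qed

lemma Im_stieltjes_transform:
  assumes "w \<in> UNIV - complex_of_real ` measure_support \<mu>"
  shows "Im (stieltjes_transform \<mu> w) = - Im w * (LINT x|\<mu>. 1 / (cmod (w - of_real x))\<^sup>2)"
proof -
  have "Im (stieltjes_transform \<mu> w) = (LINT x|\<mu>. Im (1 / (w - complex_of_real x)))"
    unfolding stieltjes_transform_def
    by (rule integral_Im[symmetric, OF integrable_stieltjes_kernel[OF assms]])
  also have "\<dots> = (LINT x|\<mu>. - Im w * (1 / (cmod (w - of_real x))\<^sup>2))"
    by (intro Bochner_Integration.integral_cong refl) (simp add: Im_divide cmod_power2)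
  also have "\<dots> = - Im w * (LINT x|\<mu>. 1 / (cmod (w - of_real x))\<^sup>2)"
    by (rule integral_mult_right_zero)
  finally show ?thesis .
qed

lemma cnj_stieltjes_transform: "stieltjes_transform \<mu> (cnj w) = cnj (stieltjes_transform \<mu> w)"
  unfolding stieltjes_transform_def Bochner_Integration.integral_cnj[symmetric]
  by (intro Bochner_Integration.integral_cong refl) simp

text \<open>Every disc meets an open half plane. If the transform were constant on the disc, then it would
  be constant on that half plane by analytic continuation, hence \<open>0\<close> because it vanishes at
  infinity; but its imaginary part does not vanish at \<open>\<plusminus>\<i>\<close> unless the measure is zero.\<close>
lemma nonconstant_stieltjes_transform:
  assumes nz: "emeasure \<mu> UNIV \<noteq> 0"
    and r: "0 < r" "ball z r \<subseteq> UNIV - complex_of_real ` measure_support \<mu>"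
  shows "\<not> stieltjes_transform \<mu> constant_on ball z r"
proof
  assume const: "stieltjes_transform \<mu> constant_on ball z r"
  \<comment> \<open>The sign that selects the upper or the lower half plane \<open>H\<close>.\<close>
  define \<sigma> :: real where "\<sigma> = (if 0 \<le> Im z then 1 else - 1)"
  have \<sigma>: "\<sigma> * \<sigma> = 1" "\<bar>\<sigma>\<bar> = 1" by (auto simp: \<sigma>_def)
  define H where "H = {w. inner (of_real \<sigma> * \<i>) w > 0}"
  have H_iff: "w \<in> H \<longleftrightarrow> 0 < \<sigma> * Im w" for w by (simp add: H_def inner_complex_def)
  have oH: "open H" unfolding H_def by (rule open_halfspace_gt)
  have cH: "connected H" unfolding H_def by (intro convex_connected convex_halfspace_gt)
  have HD: "H \<subseteq> UNIV - complex_of_real ` measure_support \<mu>" by (auto simp: H_iff)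
  define w0 where "w0 = z + of_real (\<sigma> * (r/2)) * \<i>"
  have w0: "w0 \<in> ball z r \<inter> H"
    using r(1) \<sigma>(2) by (auto simp: w0_def H_iff dist_norm norm_mult algebra_simps) (auto simp: \<sigma>_def)
  have "stieltjes_transform \<mu> constant_on H"
  proof (rule analytic_continuation')
    show "stieltjes_transform \<mu> holomorphic_on H"
      by (rule holomorphic_on_subset[OF holomorphic_stieltjes_transform HD])
    show "w0 islimpt ball z r \<inter> H" using w0 oH by (intro interior_limit_point) (auto simp: interior_open open_Int)
    show "stieltjes_transform \<mu> constant_on ball z r \<inter> H"
      using const by (auto simp: constant_on_def)
  qed (use oH cH w0 in auto)
  then obtain c where c: "\<And>w. w \<in> H \<Longrightarrow> stieltjes_transform \<mu> w = c" by (auto simp: constant_on_def)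
  have small: "cmod c \<le> measure \<mu> UNIV / t" if t: "0 < t" for t
  proof -
    define w where "w = of_real (\<sigma> * t) * \<i>"
    have wH: "w \<in> H" using t \<sigma>(1) by (simp add: w_def H_iff flip: mult.assoc)
    have "t \<le> cmod (w - complex_of_real x)" for x
      using abs_Im_le_cmod[of "w - complex_of_real x"] t \<sigma>(2) by (simp add: w_def abs_mult)
    then have le: "cmod (1 / (w - complex_of_real x)) \<le> 1 / t" for x
      using t by (simp add: norm_divide frac_le)
    have "cmod c \<le> (LINT x|\<mu>. cmod (1 / (w - complex_of_real x)))"
      unfolding c[OF wH, symmetric] stieltjes_transform_def by (rule integral_norm_bound)
    also have "\<dots> \<le> (LINT x|\<mu>. 1 / t)"
      using le integrable_stieltjes_kernel[of w] wH HD by (intro integral_mono integrable_norm) auto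
    also have "\<dots> = measure \<mu> UNIV / t"
      using sets_eq_imp_space_eq[OF sets_\<mu>] by simp
    finally show ?thesis .
  qed
  have "((\<lambda>t. measure \<mu> UNIV / t) \<longlongrightarrow> 0) at_top"
    by (intro tendsto_divide_0[OF tendsto_const] filterlim_at_top_imp_at_infinity filterlim_ident)
  then have "cmod c \<le> 0"
    by (rule tendsto_lowerbound) (auto intro: eventually_mono[OF eventually_gt_at_top[of 0]] small)
  then have "c = 0" by simp
  define w where "w = of_real \<sigma> * \<i>"
  have wH: "w \<in> H" using \<sigma>(1) by (simp add: w_def H_iff)
  have "(LINT x|\<mu>. 1 / (cmod (w - of_real x))\<^sup>2) = 0"
  proof -
    have "Im w \<noteq> 0" using \<sigma>(2) by (auto simp: w_def)
    then show ?thesis using Im_stieltjes_transform[of w] c[OF wH] \<open>c = 0\<close> wH HD by auto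
  qed
  moreover have "integrable \<mu> (\<lambda>x. 1 / (cmod (w - of_real x))\<^sup>2)"
  proof (rule integrable_const_bound[where B = 1])
    have "1 \<le> cmod (w - complex_of_real x)" for x
      using abs_Im_le_cmod[of "w - complex_of_real x"] \<sigma>(2) by (simp add: w_def)
    then have "1 / (cmod (w - complex_of_real x))\<^sup>2 \<le> 1 / 1" for x
      by (intro frac_le one_le_power) auto
    then show "AE x in \<mu>. norm (1 / (cmod (w - of_real x))\<^sup>2) \<le> 1"
      by (intro AE_I2) simp
  qed (unfold measurable_cong_sets[OF sets_\<mu> refl], measurable)
  ultimately have "AE x in \<mu>. 1 / (cmod (w - of_real x))\<^sup>2 = 0"
    by (subst (asm) integral_nonneg_eq_0_iff_AE) auto
  moreover have "w - of_real x \<noteq> 0" for x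
    using \<sigma>(2) by (auto simp: w_def complex_eq_iff)
  ultimately have "AE x in \<mu>. False" by simp
  then have "emeasure \<mu> (space \<mu>) = 0" by (simp add: AE_iff_null null_setsD1)
  then show False using nz sets_eq_imp_space_eq[OF sets_\<mu>] by simp
qed

end

section \<open>The density and its modified graph\<close>

lemma abs_continuous_on_imp_uniformly_continuous_on:
  assumes "abs_continuous_on A f" "is_interval A"
  shows "uniformly_continuous_on A f"
  unfolding uniformly_continuous_on_def
proof (intro allI impI)
  fix e :: real assume "0 < e"
  then obtain d where d: "0 < d" "\<And>D. D division_of \<Union>D \<Longrightarrow> \<Union>D \<subseteq> A \<Longrightarrow>
      (\<Sum>k\<in>D. Sup k - Inf k) < d \<Longrightarrow> (\<Sum>k\<in>D. \<bar>f (Sup k) - f (Inf k)\<bar>) < e"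
    using assms(1) unfolding abs_continuous_on_def by meson
  have *: "\<bar>f v - f u\<bar> < e" if "u \<in> A" "v \<in> A" "u \<le> v" "v - u < d" for u v
  proof -
    have "{u..v} \<subseteq> A"
      using assms(2) that unfolding is_interval_1 by (meson atLeastAtMost_iff subsetI)
    moreover have "{{u..v}} division_of \<Union>{{u..v}}"
      using division_of_self[of u v] that(3) by (simp add: cbox_interval)
    ultimately show ?thesis using d(2)[of "{{u..v}}"] that(3,4) by simp
  qed
  show "\<exists>d>0. \<forall>x\<in>A. \<forall>x'\<in>A. dist x' x < d \<longrightarrow> dist (f x') (f x) < e"
  proof (intro exI[of _ d] conjI ballI impI d(1))
    fix x x' assume "x \<in> A" "x' \<in> A" "dist x' x < d"
    then show "dist (f x') (f x) < e"
      using *[of x x'] *[of x' x] by (cases "x \<le> x'") (auto simp: dist_real_def abs_minus_commute)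
  qed
qed

text \<open>For finite one-sided limits the extended reals in the definition of the modified graph can be
  dropped, because limits are unique.\<close>
lemma modified_graph_tendsto:
  assumes "(f \<longlongrightarrow> l) (at_left x)" "(f \<longlongrightarrow> r) (at_right x)"
  shows "(x, y) \<in> modified_graph f \<longleftrightarrow> min l r \<le> y \<and> y \<le> max l r"
proof -
  have lim: "((\<lambda>z. ereal (f z)) \<longlongrightarrow> ereal l) (at_left x)" "((\<lambda>z. ereal (f z)) \<longlongrightarrow> ereal r) (at_right x)"
    using assms by (auto intro: tendsto_ereal)
  have "(x, y) \<in> modified_graph f \<longleftrightarrow> min (ereal l) (ereal r) \<le> ereal y \<and> ereal y \<le> max (ereal l) (ereal r)"
    unfolding modified_graph_def
    using lim tendsto_unique[OF trivial_limit_at_left_real lim(1)] tendsto_unique[OF trivial_limit_at_right_real lim(2)]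
    by auto
  then show ?thesis by (simp add: min_def max_def)
qed

lemma modified_graph_isCont:
  assumes "isCont f x"
  shows "(x, y) \<in> modified_graph f \<longleftrightarrow> y = f x"
  using modified_graph_tendsto[of f "f x" x "f x"] assms
  by (auto simp: isCont_def filterlim_at_split)

text \<open>The equivalence classes are turned into points: one point is picked in each class, and every
  point of the set is joined to one of them by a segment inside the set.\<close>
lemma num_components_representatives:
  assumes "num_components A = enat n"
  obtains X where "X \<subseteq> A" "finite X" "card X \<le> n" "\<And>x. x \<in> A \<Longrightarrow> \<exists>x'\<in>X. closed_segment x x' \<subseteq> A"
proof -
  have fin: "finite (A // segment_rel A)" and card: "card (A // segment_rel A) = n"
    using assms by (auto simp: num_components_def split: if_splits)
  define pick where "pick C = (SOME x. x \<in> C)" for C :: "real set"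
  have pick: "pick (segment_rel A `` {x}) \<in> segment_rel A `` {x}" if "x \<in> A" for x
  proof -
    have "x \<in> segment_rel A `` {x}" using that by (simp add: segment_rel_def)
    then show ?thesis unfolding pick_def by (rule someI)
  qed
  show thesis
  proof
    show "pick ` (A // segment_rel A) \<subseteq> A"
      using pick by (auto simp: quotient_def segment_rel_def)
    show "finite (pick ` (A // segment_rel A))" using fin by simp
    show "card (pick ` (A // segment_rel A)) \<le> n" using card_image_le[OF fin] card by simp
    show "\<exists>x'\<in>pick ` (A // segment_rel A). closed_segment x x' \<subseteq> A" if "x \<in> A" for x
      using pick[OF that] that
      by (intro bexI[of _ "pick (segment_rel A `` {x})"] imageI quotientI) (auto simp: segment_rel_def)
  qed
qed

lemma isCont_outside_closed:
  fixes f :: "real \<Rightarrow> real"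
  assumes "closed K" "x \<notin> K" "\<And>x. x \<notin> K \<Longrightarrow> f x = c"
  shows "isCont f x"
proof -
  have "\<forall>\<^sub>F u in nhds x. f u = c"
    using assms by (auto simp: eventually_nhds intro!: exI[of _ "- K"])
  then show ?thesis using isCont_cong[of f "\<lambda>_. c" x] by simp
qed

text \<open>The intermediate value theorem for the modified graph. Inside the interval it is the usual one.
  If one of the two points lies beyond an endpoint, then the level \<open>y\<close> is either passed before that
  endpoint or lies in the jump of \<open>\<rho>\<close> there.\<close>
lemma level_crossing:
  fixes \<rho> :: "real \<Rightarrow> real"
  assumes ucont: "uniformly_continuous_on {a<..<b} \<rho>"
    and zero: "\<And>x. x \<notin> {a..b} \<Longrightarrow> \<rho> x = 0"
    and y: "0 < y"
    and uv: "u \<notin> {a, b}" "v \<notin> {a, b}" "u < v" "(\<rho> u - y) * (\<rho> v - y) < 0"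
  shows "\<exists>x. u < x \<and> x < v \<and> (x, y) \<in> modified_graph \<rho>"
proof -
  have cont: "continuous_on {a<..<b} \<rho>" using ucont by (rule uniformly_continuous_imp_continuous)
  have isCont: "isCont \<rho> x" if "x \<in> {a<..<b}" for x
    using cont that by (simp add: continuous_on_eq_continuous_at)
  have inside: "\<exists>x. s < x \<and> x < t \<and> (x, y) \<in> modified_graph \<rho>"
    if st: "a < s" "s < t" "t < b" "(\<rho> s - y) * (\<rho> t - y) < 0" for s t
  proof -
    have "continuous_on {s..t} \<rho>" using cont by (rule continuous_on_subset) (use st in auto)
    then obtain x where x: "s \<le> x" "x \<le> t" "\<rho> x = y"
      using IVT'[of \<rho> s y t] IVT2'[of \<rho> t y s] st by (fastforce simp: mult_less_0_iff)
    moreover have "x \<noteq> s" "x \<noteq> t" using st(4) x(3) by auto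
    moreover have "(x, y) \<in> modified_graph \<rho>"
      using x st by (subst modified_graph_isCont) (auto intro!: isCont)
    ultimately show ?thesis by force
  qed
  consider "\<rho> u > y" "\<rho> v < y" | "\<rho> u < y" "\<rho> v > y" using uv(4) by (auto simp: mult_less_0_iff)
  then show ?thesis
  proof cases
    case 1
    then have u: "a < u" "u < b" using zero[of u] y uv(1) by (force simp: not_le)+
    show ?thesis
    proof (cases "v < b")
      case True
      then show ?thesis using inside[of u v] u uv by blast
    next
      case False
      then have v: "b < v" using uv(2) by auto
      obtain l where "(\<rho> \<longlongrightarrow> l) (at b within {a<..<b})"
        using uniformly_continuous_on_extension_at_closure[OF ucont, of b] u by auto
      moreover have "at b within {a<..<b} = at_left b"
        using u by (intro at_within_nhd[of b "{a<..}"]) auto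
      ultimately have l: "(\<rho> \<longlongrightarrow> l) (at_left b)" by simp
      have "\<forall>\<^sub>F x in at_right b. \<rho> x = 0"
        using eventually_at_right_less[of b] by eventually_elim (auto intro: zero)
      then have r: "(\<rho> \<longlongrightarrow> 0) (at_right b)" by (simp add: filterlim_cong)
      show ?thesis
      proof (cases "y \<le> l")
        case True
        then have "(b, y) \<in> modified_graph \<rho>" using modified_graph_tendsto[OF l r] y by auto
        then show ?thesis using u v by blast
      next
        case False
        have "\<forall>\<^sub>F x in at_left b. \<rho> x < y \<and> u < x \<and> x < b"
          using order_tendstoD(2)[OF l, of y] False eventually_at_left_real[OF u(2)]
          by (auto intro: eventually_conj elim: eventually_elim2)
        then obtain t where t: "\<rho> t < y" "u < t" "t < b"
          using eventually_happens trivial_limit_at_left_real by blast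
        then show ?thesis using inside[of u t] u 1 v by (force simp: mult_pos_neg)
      qed
    qed
  next
    case 2
    then have v: "a < v" "v < b" using zero[of v] y uv(2) by (force simp: not_le)+
    show ?thesis
    proof (cases "a < u")
      case True
      then show ?thesis using inside[of u v] v uv by blast
    next
      case False
      then have u: "u < a" using uv(1) by auto
      obtain r where "(\<rho> \<longlongrightarrow> r) (at a within {a<..<b})"
        using uniformly_continuous_on_extension_at_closure[OF ucont, of a] v by auto
      moreover have "at a within {a<..<b} = at_right a"
        using v by (intro at_within_nhd[of a "{..<b}"]) auto
      ultimately have r: "(\<rho> \<longlongrightarrow> r) (at_right a)" by simp
      have "\<forall>\<^sub>F x in at_left a. x < a"
        by (auto simp: eventually_at_left_field intro: exI[of _ "a - 1"])
      then have "\<forall>\<^sub>F x in at_left a. \<rho> x = 0"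
        by eventually_elim (auto intro: zero)
      then have l: "(\<rho> \<longlongrightarrow> 0) (at_left a)" by (simp add: filterlim_cong)
      show ?thesis
      proof (cases "y \<le> r")
        case True
        then have "(a, y) \<in> modified_graph \<rho>" using modified_graph_tendsto[OF l r] y by auto
        then show ?thesis using u v by blast
      next
        case False
        have "\<forall>\<^sub>F x in at_right a. \<rho> x < y \<and> a < x \<and> x < v"
          using order_tendstoD(2)[OF r, of y] False eventually_at_right_real[OF v(1)]
          by (auto intro: eventually_conj elim: eventually_elim2)
        then obtain t where t: "\<rho> t < y" "a < t" "t < v"
          using eventually_happens trivial_limit_at_right_real by blast
        have "(\<rho> t - y) * (\<rho> v - y) < 0" using t(1) 2(2) by (intro mult_neg_pos) auto
        then obtain x where "t < x" "x < v" "(x, y) \<in> modified_graph \<rho>"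
          using inside[of t v] t v by blast
        then show ?thesis using t(2) u by (intro exI[of _ x]) auto
      qed
    qed
  qed
qed

lemma integrable_uniformly_continuous_compact_support:
  fixes \<rho> :: "real \<Rightarrow> real"
  assumes ucont: "uniformly_continuous_on {a<..<b} \<rho>"
    and zero: "\<And>x. x \<notin> {a..b} \<Longrightarrow> \<rho> x = 0"
  shows "integrable lborel \<rho>"
proof -
  have "bounded (\<rho> ` {a<..<b})"
    using ucont by (rule bounded_uniformly_continuous_image) simp
  then obtain C where C: "\<And>x. x \<in> {a<..<b} \<Longrightarrow> \<bar>\<rho> x\<bar> \<le> C"
    unfolding bounded_iff by force
  let ?f = "\<lambda>x. indicator {a<..<b} x *\<^sub>R \<rho> x"
  have f: "?f \<in> borel_measurable borel"
    using ucont by (intro borel_measurable_continuous_on_indicator uniformly_continuous_imp_continuous) auto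
  have "integrable lborel ?f"
    using f C emeasure_bounded_finite[of "{a<..<b}"]
    by (intro integrableI_bounded_set[where A = "{a<..<b}" and B = C]) (auto intro!: AE_I2)
  moreover have "AE x in lborel. x \<notin> {a, b}"
    by (intro AE_not_in finite_imp_null_set_lborel) auto
  ultimately show ?thesis
  proof (subst integrable_cong_AE[where g = ?f])
    have "\<rho> = (\<lambda>x. ?f x + (if x = a then \<rho> a else if x = b then \<rho> b else 0))"
      using zero by (force simp: indicator_def)
    also have "\<dots> \<in> borel_measurable borel" using f by measurable
    finally show "\<rho> \<in> borel_measurable lborel" by simp
    assume "AE x in lborel. x \<notin> {a, b}"
    then show "AE x in lborel. \<rho> x = ?f x"
      by eventually_elim (use zero in \<open>force simp: indicator_def\<close>)
  qed (use f in auto)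
qed

lemma stieltjes_transform_density:
  assumes "\<rho> \<in> borel_measurable lborel" "\<And>x. 0 \<le> \<rho> x"
  shows "stieltjes_transform (density lborel (\<lambda>x. ennreal (\<rho> x))) z =
    (LINT x|lborel. complex_of_real (\<rho> x) / (z - of_real x))"
  unfolding stieltjes_transform_def using assms
  by (subst integral_density) (auto simp: scaleR_conv_of_real)

lemma finite_measure_density_integrable:
  fixes \<rho> :: "'a \<Rightarrow> real"
  assumes "integrable M \<rho>" "\<And>x. 0 \<le> \<rho> x"
  shows "finite_measure (density M (\<lambda>x. ennreal (\<rho> x)))"
proof
  have "emeasure (density M (\<lambda>x. ennreal (\<rho> x))) (space M) = (\<integral>\<^sup>+x. ennreal (\<rho> x) \<partial>M)"
    using assms(1) by (subst emeasure_density) (auto intro!: nn_integral_cong)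
  also have "\<dots> = ennreal (integral\<^sup>L M \<rho>)"
    using assms by (intro nn_integral_eq_integral) auto
  finally show "emeasure (density M (\<lambda>x. ennreal (\<rho> x))) (space (density M (\<lambda>x. ennreal (\<rho> x)))) \<noteq> \<infinity>"
    by simp
qed

text \<open>One representative is picked in each component of the level set \<open>A\<close> of the modified graph.
  Between two points of opposite sign of \<open>\<rho> - y\<close> the level is crossed at some point of \<open>A\<close>; both
  points lie outside \<open>A\<close>, so the whole component of the crossing, and with it the representative,
  stays between them. Hence the sign changes of \<open>\<rho> - y\<close> can be located at representatives.\<close>
lemma two_card_solutions_le_components:
  fixes \<rho> :: "real \<Rightarrow> real"
  assumes ucont: "uniformly_continuous_on {a<..<b} \<rho>"
    and zero: "\<And>x. x \<notin> {a..b} \<Longrightarrow> \<rho> x = 0"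
    and y: "0 < y" "Im \<zeta> = - pi * y"
    and n: "num_components {x. (x, y) \<in> modified_graph \<rho>} = enat n"
    and Z: "finite Z" "\<And>z. z \<in> Z \<Longrightarrow> 0 < Im z"
      "\<And>z. z \<in> Z \<Longrightarrow> (LINT x|lborel. complex_of_real (\<rho> x) / (z - of_real x)) = \<zeta>"
  shows "2 * card Z \<le> n"
proof -
  define A where "A = {x. (x, y) \<in> modified_graph \<rho>}"
  \<comment> \<open>At the points \<open>a\<close> and \<open>b\<close> the value of \<open>\<rho>\<close> is unrelated to the modified graph.\<close>
  define D where "D = {u. u \<notin> {a, b} \<and> \<rho> u \<noteq> y}"
  obtain X where X: "X \<subseteq> A" "finite X" "card X \<le> n"
      "\<And>x. x \<in> A \<Longrightarrow> \<exists>x'\<in>X. closed_segment x x' \<subseteq> A"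
    using num_components_representatives[OF n] unfolding A_def by blast
  have D_A: "u \<notin> A" if u: "u \<in> D" for u
  proof -
    have "isCont \<rho> u"
    proof (cases "u \<in> {a<..<b}")
      case True
      then show ?thesis
        using uniformly_continuous_imp_continuous[OF ucont] by (simp add: continuous_on_eq_continuous_at)
    next
      case False
      then have "u \<notin> {a..b}" using u by (auto simp: D_def)
      then show ?thesis using zero by (intro isCont_outside_closed[of "{a..b}"]) auto
    qed
    then show ?thesis using u by (simp add: A_def D_def modified_graph_isCont)
  qed
  have "\<exists>Y\<subseteq>X. even (card Y) \<and> (\<forall>u\<in>D. (\<Prod>t\<in>Y. u - t) * (\<rho> u - y) \<le> 0)"
  proof (rule even_sign_polynomial)
    show "D \<inter> X = {}" using D_A X(1) by blast
    show "u \<in> D \<and> \<rho> u - y < 0" if "max \<bar>a\<bar> \<bar>b\<bar> < \<bar>u\<bar>" for u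
    proof -
      have "u \<notin> {a..b}" "u \<noteq> a" "u \<noteq> b" using that by auto
      then show ?thesis using zero[of u] y(1) by (simp add: D_def)
    qed
    fix u v assume uv: "u \<in> D" "v \<in> D" "u < v" "(\<rho> u - y) * (\<rho> v - y) < 0"
    then obtain x where x: "u < x" "x < v" "x \<in> A"
      using level_crossing[OF ucont zero y(1), of u v] by (auto simp: D_def A_def)
    then obtain x' where x': "x' \<in> X" "closed_segment x x' \<subseteq> A" using X(4) by blast
    have "u \<notin> closed_segment x x'" "v \<notin> closed_segment x x'"
      using x'(2) D_A uv(1,2) by auto
    then have "u < x' \<and> x' < v"
      using x(1,2) by (auto simp: closed_segment_eq_real_ivl split: if_splits)
    then show "\<exists>x\<in>X. u < x \<and> x < v" using x'(1) by blast
  qed (use X(2) in auto)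
  then obtain Y where Y: "Y \<subseteq> X" "even (card Y)"
      "\<And>u. u \<in> D \<Longrightarrow> (\<Prod>t\<in>Y. u - t) * (\<rho> u - y) \<le> 0"
    by blast
  have fY: "finite Y" using Y(1) X(2) by (rule finite_subset)
  have "2 * card Z \<le> card Y"
  proof (rule level_crossings_bound_zeros[OF _ _ y Z fY Y(2)])
    show "integrable lborel \<rho>"
      using ucont zero by (rule integrable_uniformly_continuous_compact_support)
    show "\<rho> x = 0" if "max \<bar>a\<bar> \<bar>b\<bar> < \<bar>x\<bar>" for x
      using that by (intro zero) auto
    have "AE x in lborel. x \<notin> {a, b}"
      by (intro AE_not_in finite_imp_null_set_lborel) auto
    then show "AE x in lborel. (\<Prod>t\<in>Y. x - t) * (\<rho> x - y) \<le> 0"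
    proof eventually_elim
      case (elim x)
      then show ?case using Y(3)[of x] by (cases "\<rho> x = y") (auto simp: D_def)
    qed
  qed
  also have "card Y \<le> card X" using X(2) Y(1) by (rule card_mono)
  also have "\<dots> \<le> n" by (rule X(3))
  finally show ?thesis .
qed

section \<open>The bound on the number of solutions\<close>

lemma nowhere_dense_avoid:
  fixes S :: "real set"
  assumes "interior (closure S) = {}" "u < v"
  obtains y where "u < y" "y < v" "y \<notin> S"
proof -
  have "\<not> {u<..<v} \<subseteq> closure S"
    using assms interior_maximal[of "{u<..<v}" "closure S"] by (auto simp: not_le[symmetric])
  then show thesis using that closure_subset[of S] by (auto simp: subset_iff)
qed

theorem theorem4p3:
  fixes \<mu> :: "real measure" and \<rho> :: "real \<Rightarrow> real" and a b p :: real
    and S :: "real set" and \<zeta> :: complex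
  assumes "sets \<mu> = sets borel"
    and "emeasure \<mu> UNIV \<noteq> 0"
    and "measure_support \<mu> \<subseteq> {a..b}"
    and "\<mu> = density lborel (\<lambda>x. ennreal (\<rho> x))"
    and "\<And>x. \<rho> x \<ge> 0"
    and "\<And>x. x \<notin> {a..b} \<Longrightarrow> \<rho> x = 0"
    and "1 < p"
    and "\<rho> \<in> sobolev_W1 p {a<..<b}"
    and "abs_continuous_on {a<..<b} \<rho>"
    and "interior (closure S) = {}"
  shows "num_solutions (stieltjes_transform \<mu>) (UNIV - complex_of_real ` measure_support \<mu>) \<zeta>
    \<le> ennreal_of_enat (SUP y\<in>{y. 0 < y \<and> y \<notin> S}.
          num_components {x. (x, y) \<in> modified_graph \<rho>}) / 2"
proof -
  let ?D = "UNIV - complex_of_real ` measure_support \<mu>"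
  let ?G = "stieltjes_transform \<mu>"
  have ucont: "uniformly_continuous_on {a<..<b} \<rho>"
    by (intro abs_continuous_on_imp_uniformly_continuous_on assms(9)) (simp add: is_interval_1)
  have int: "integrable lborel \<rho>"
    using ucont assms(6) by (rule integrable_uniformly_continuous_compact_support)
  have fin: "finite_measure \<mu>"
    unfolding assms(4) using int assms(5) by (rule finite_measure_density_integrable)
  have G: "?G z = (LINT x|lborel. complex_of_real (\<rho> x) / (z - of_real x))" for z
    unfolding assms(4) using int assms(5) by (intro stieltjes_transform_density) auto
  have sgn_Im: "0 < s * Im w" if "w \<in> ?D" "s * Im (?G w) < 0" for w s
  proof -
    have "0 \<le> (LINT x|\<mu>. 1 / (cmod (w - of_real x))\<^sup>2)" (is "0 \<le> ?I")
      by (intro Bochner_Integration.integral_nonneg) auto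
    moreover have "0 < (s * Im w) * ?I"
      using that(2) Im_stieltjes_transform[OF assms(1) fin that(1)] by (simp add: mult_ac)
    ultimately show ?thesis by (metis less_le_not_le mult_nonpos_nonneg not_le)
  qed
  show ?thesis
  proof (cases "SUP y\<in>{y. 0 < y \<and> y \<notin> S}. num_components {x. (x, y) \<in> modified_graph \<rho>}")
    case infinity
    then show ?thesis by (simp add: ennreal_top_divide)
  next
    case (enat N)
    have comp: "\<exists>n\<le>N. num_components {x. (x, y) \<in> modified_graph \<rho>} = enat n" if "0 < y" "y \<notin> S" for y
    proof -
      have "num_components {x. (x, y) \<in> modified_graph \<rho>} \<le> enat N"
        unfolding enat[symmetric] using that by (intro SUP_upper) auto
      then show ?thesis by (cases "num_components {x. (x, y) \<in> modified_graph \<rho>}") auto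
    qed
    show ?thesis
    proof (rule num_solutions_leI)
      fix Z assume Z: "finite Z" "Z \<subseteq> {z \<in> ?D. ?G z = \<zeta>}"
      define m where "m = (\<Sum>z\<in>Z. nat (zorder (\<lambda>w. ?G w - \<zeta>) z))"
      have "\<exists>\<delta>>0. \<forall>\<zeta>'. 0 < dist \<zeta>' \<zeta> \<longrightarrow> dist \<zeta>' \<zeta> < \<delta> \<longrightarrow>
          (\<exists>W \<subseteq> ?D. finite W \<and> card W = m \<and> (\<forall>w\<in>W. ?G w = \<zeta>'))"
        unfolding m_def
        by (rule solutions_stable[OF open_stieltjes_domain holomorphic_stieltjes_transform[OF assms(1) fin]
          nonconstant_stieltjes_transform[OF assms(1) fin assms(2)]]) (use Z in auto)
      then obtain \<delta> where \<delta>: "0 < \<delta>" "\<And>\<zeta>'. 0 < dist \<zeta>' \<zeta> \<Longrightarrow> dist \<zeta>' \<zeta> < \<delta> \<Longrightarrow>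
          \<exists>W \<subseteq> ?D. finite W \<and> card W = m \<and> (\<forall>w\<in>W. ?G w = \<zeta>')"
        by blast
      \<comment> \<open>The value is moved away from the real axis, onto the level \<open>-\<sigma> \<pi> y\<close> with \<open>y \<notin> S\<close>.\<close>
      define \<sigma> :: real where "\<sigma> = (if Im \<zeta> \<le> 0 then 1 else - 1)"
      have \<sigma>: "\<bar>\<sigma>\<bar> = 1" "Im \<zeta> = - \<sigma> * \<bar>Im \<zeta>\<bar>" "\<sigma> * \<sigma> = 1" by (auto simp: \<sigma>_def)
      obtain y where y: "\<bar>Im \<zeta>\<bar> / pi < y" "y < (\<bar>Im \<zeta>\<bar> + \<delta>) / pi" "y \<notin> S"
        using nowhere_dense_avoid[OF assms(10), of "\<bar>Im \<zeta>\<bar> / pi" "(\<bar>Im \<zeta>\<bar> + \<delta>) / pi"] \<delta>(1)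
        by (auto simp: divide_strict_right_mono)
      have y0: "0 < y" using y(1) by (rule le_less_trans[rotated]) simp
      have y': "0 < pi * y - \<bar>Im \<zeta>\<bar>" "pi * y - \<bar>Im \<zeta>\<bar> < \<delta>"
        using y(1,2) by (simp_all add: field_simps)
      define \<zeta>' where "\<zeta>' = Complex (Re \<zeta>) (- \<sigma> * (pi * y))"
      have "\<zeta>' - \<zeta> = of_real (- \<sigma> * (pi * y - \<bar>Im \<zeta>\<bar>)) * \<i>"
        using \<sigma>(2) by (simp add: \<zeta>'_def complex_eq_iff right_diff_distrib)
      then have "dist \<zeta>' \<zeta> = \<bar>\<sigma>\<bar> * \<bar>pi * y - \<bar>Im \<zeta>\<bar>\<bar>"
        by (simp only: dist_norm norm_mult norm_of_real abs_mult abs_minus_cancel norm_ii mult_1_right)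
      then have "0 < dist \<zeta>' \<zeta>" "dist \<zeta>' \<zeta> < \<delta>" using y' \<sigma>(1) by simp_all
      then have "\<exists>W \<subseteq> ?D. finite W \<and> card W = m \<and> (\<forall>w\<in>W. ?G w = \<zeta>')"
        by (rule \<delta>(2))
      then obtain W where W: "W \<subseteq> ?D" "finite W" "card W = m" "\<And>w. w \<in> W \<Longrightarrow> ?G w = \<zeta>'"
        by (elim exE conjE) (rule that, auto)
      \<comment> \<open>For \<open>\<sigma> = -1\<close> the solutions lie in the lower half plane and are reflected.\<close>
      define V where "V = (if \<sigma> = 1 then W else cnj ` W)"
      obtain n where n: "n \<le> N" "num_components {x. (x, y) \<in> modified_graph \<rho>} = enat n"
        using comp[OF y0 y(3)] by blast
      have Im_W: "0 < \<sigma> * Im w" if "w \<in> W" for w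
        using W(1,4) that y0 \<sigma>(3) by (intro sgn_Im) (auto simp: \<zeta>'_def simp flip: mult.assoc)
      have "2 * card V \<le> n"
      proof (rule two_card_solutions_le_components[OF ucont assms(6) y0 _ n(2)])
        show "Im (Complex (Re \<zeta>) (- pi * y)) = - pi * y" by simp
        show "finite V" using W(2) by (simp add: V_def)
        show "0 < Im v" if "v \<in> V" for v
          using that Im_W by (auto simp: V_def \<sigma>_def split: if_splits)
        show "(LINT x|lborel. complex_of_real (\<rho> x) / (v - of_real x)) = Complex (Re \<zeta>) (- pi * y)"
          if "v \<in> V" for v
          unfolding G[symmetric]
          using that W(4) cnj_stieltjes_transform[OF assms(1) fin]
          by (cases "Im \<zeta> \<le> 0") (auto simp: V_def \<zeta>'_def \<sigma>_def complex_eq_iff)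
      qed auto
      moreover have "card V = m" using W(3) by (simp add: V_def card_image inj_on_def)
      ultimately have "real m \<le> real N / 2" using n(1) by linarith
      then have "ennreal (real m) \<le> ennreal (real N / 2)" by (rule ennreal_leI)
      then show "of_nat (\<Sum>z\<in>Z. nat (zorder (\<lambda>w. ?G w - \<zeta>) z)) \<le>
          ennreal_of_enat (SUP y\<in>{y. 0 < y \<and> y \<notin> S}. num_components {x. (x, y) \<in> modified_graph \<rho>}) / 2"
        unfolding m_def[symmetric] enat
        by (simp add: ennreal_of_nat_eq_real_of_nat ennreal_divide_numeral)
    qed
  qed
qed

end
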